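(* Let $n \geq 2$ and let $I = \{i_1 < \cdots < i_k\} \subset [n-1]$ be such that for some $1 \leq s \leq k$, \[ i_1, \ldots, i_{k-s+1} \leq n-k, \qquad i_{k-s+\ell} = n-s+\ell-1 \text{ for } 2 \leq \ell \leq s \] (i.e. $i_{k-s+2} = n-s+1, \ldots, i_k = n-1$). Let $0 \leq u \leq s$. Then \[ \sum_J (-1)^d\, \Delta_s(j_{k-s+1}, \ldots, j_k) \binom{d+u}{u}\, \partial_{e_{n-s-d}(x_1, \ldots, x_{n-s+u})}\, \mathrm{d}_{j_1} \cdots \mathrm{d}_{j_k} \Delta_n = 0, \] where the sum is over all subsets $J = \{j_1 < \cdots < j_k\} \subset [n-1]$ with $j_1 = i_1, \ldots, j_{k-s} = i_{k-s}$ and $d = (j_{k-s+1} - i_{k-s+1}) + \cdots + (j_k - i_k) \geq 0$.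
   Context: Work in $\mathbb{Q}[x_1, \ldots, x_n, \theta_1, \ldots, \theta_n]$ where the $x_i$ commute, the $\theta_i$ anticommute, and $x_i$ commutes with $\theta_j$. $\Delta_n = \prod_{1 \leq i < j \leq n}(x_j - x_i)$ and, for numbers $y_1, \ldots, y_s$, $\Delta_s(y_1, \ldots, y_s) = \prod_{1 \leq v < w \leq s}(y_w - y_v)$. For a polynomial $g \in \mathbb{Q}[x_1, \ldots, x_n]$, $\partial_g$ is obtained by substituting $\partial_{x_i}$ for $x_i$. For $i \geq 1$, $\mathrm{d}_i \omega = \sum_{j=1}^n \theta_j\, \partial_{x_j}^i \omega$. $e_r(x_1, \ldots, x_m)$ is the elementary symmetric polynomial, with $e_0 = 1$ and $e_r = 0$ for $r < 0$ or $r > m$. *)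

theory Defs
  imports Complex_Main "HOL-Library.Poly_Mapping"
begin

type_synonym mpoly = "(nat \<Rightarrow>\<^sub>0 nat) \<Rightarrow>\<^sub>0 rat"

text \<open>Elements of Q[x, theta]: the coefficient of theta_S = theta_{s1} theta_{s2} ...
  (s1 < s2 < ..., S finite) is a polynomial in the x's.\<close>
type_synonym spoly = "nat set \<Rightarrow> mpoly"

definition Xv :: "nat \<Rightarrow> mpoly" where
  "Xv i = Poly_Mapping.single (Poly_Mapping.single i 1) 1"

definition pd :: "nat \<Rightarrow> mpoly \<Rightarrow> mpoly" where
  "pd i p = (\<Sum>m\<in>Poly_Mapping.keys p. Poly_Mapping.single (m - Poly_Mapping.single i (1::nat))
                                ((of_nat (Poly_Mapping.lookup m i) :: rat) * Poly_Mapping.lookup p m))"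

definition cst :: "rat \<Rightarrow> mpoly" where
  "cst c = Poly_Mapping.single 0 c"

definition diffop :: "mpoly \<Rightarrow> mpoly \<Rightarrow> mpoly" where
  "diffop g p = (\<Sum>m\<in>Poly_Mapping.keys g. cst (Poly_Mapping.lookup g m) *
       fold (\<lambda>i. pd i ^^ Poly_Mapping.lookup m i) (sorted_list_of_set (Poly_Mapping.keys m)) p)"

text \<open>Elementary symmetric polynomial e_r(x_1,...,x_m); zero for r < 0 or r > m.\<close>
definition esym :: "nat \<Rightarrow> int \<Rightarrow> mpoly" where
  "esym m r = (if r < 0 then 0 else
      (\<Sum>A\<in>{A. A \<subseteq> {1..m} \<and> card A = nat r}. \<Prod>a\<in>A. Xv a))"

definition vdm_poly :: "nat \<Rightarrow> mpoly" where
  "vdm_poly n = (\<Prod>(i,j)\<in>{(i,j). 1 \<le> i \<and> i < j \<and> j \<le> n}. Xv j - Xv i)"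

definition vdm_num :: "nat list \<Rightarrow> rat" where
  "vdm_num ys = (\<Prod>(v,w)\<in>{(v,w). v < w \<and> w < length ys}. of_nat (ys!w) - of_nat (ys!v))"

definition sconst :: "mpoly \<Rightarrow> spoly" where
  "sconst p = (\<lambda>S. if S = {} then p else 0)"

text \<open>Left multiplication by theta_j (anticommuting variables, theta_j theta_j = 0).\<close>
definition theta_mul :: "nat \<Rightarrow> spoly \<Rightarrow> spoly" where
  "theta_mul j w = (\<lambda>T. if j \<in> T then (-1) ^ card {t\<in>T. t < j} * w (T - {j}) else 0)"

definition dop :: "nat \<Rightarrow> nat \<Rightarrow> spoly \<Rightarrow> spoly" where
  "dop n i w = (\<lambda>T. \<Sum>j=1..n. theta_mul j (\<lambda>S. (pd j ^^ i) (w S)) T)"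

definition dprod :: "nat \<Rightarrow> nat list \<Rightarrow> spoly \<Rightarrow> spoly" where
  "dprod n js w = foldr (dop n) js w"

text \<open>d = (j_{k-s+1} - i_{k-s+1}) + ... + (j_k - i_k) (0-indexed lists).\<close>
definition dsum :: "nat \<Rightarrow> nat \<Rightarrow> nat list \<Rightarrow> nat list \<Rightarrow> int" where
  "dsum k s js is = (\<Sum>l\<in>{k-s..<k}. int (js!l) - int (is!l))"

end

theory Submission
  imports Defs "Jordan_Normal_Form.Determinant" "HOL-Computational_Algebra.Formal_Power_Series"
begin

text \<open>
  Writing \<open>\<partial>\<close> for the substitution of partial derivatives, let \<open>K\<close> be the ideal of all \<open>f\<close> with
  \<open>f(\<partial>) \<Delta>\<^sub>n = 0\<close>.  The coefficient of a \<open>\<theta>\<close>-monomial in \<open>d\<^bsub>j\<^sub>1\<^esub> \<dots> d\<^bsub>j\<^sub>k\<^esub> \<Delta>\<^sub>n\<close> is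
  \<open>det(x\<^bsub>t\<^esub>\<^bsup>j\<^esup>)(\<partial>) \<Delta>\<^sub>n\<close>, so a membership in \<open>K\<close> has to be shown.  Antisymmetry of \<open>\<Delta>\<^sub>n\<close> puts into
  \<open>K\<close> every homogeneous polynomial that is symmetric in the variables outside \<open>Z\<close> and has degree
  above \<open>binomial(n,2) - binomial(n-|Z|,2)\<close>; in particular the product of all \<open>1 - x\<^sub>i t\<close> is \<open>1\<close> modulo \<open>K\<close>.

  Expanding the determinant along the fixed indices leaves the last \<open>s\<close> ones and a set \<open>Y\<close> of \<open>s\<close>
  variables.  The condition \<open>d \<ge> 0\<close> and the bound \<open>j < n\<close> are automatic modulo \<open>K\<close>, and
  \<open>binomial(d+u,u) e\<^bsub>n-s-d\<^esub>(x\<^sub>1,\<dots>,x\<^bsub>n-s+u\<^esub>)\<close> is the sum of \<open>e\<^bsub>n-s-d\<^esub>(A)\<close> over the subsets \<open>A\<close> with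
  \<open>n-s\<close> elements.  Since the sum over all tuples of \<open>\<Delta>(j) z\<^bsup>j\<^esup>\<close> is a multiple of
  \<open>\<Delta>(z) / (\<Prod>(1 - z\<^sub>l))\<^bsup>s\<^esup>\<close>, the claim becomes the vanishing modulo \<open>K\<close> of one coefficient of
  \<open>\<Delta>(Y) \<Prod>\<^bsub>w\<^esub> (\<Prod>\<^bsub>x\<^esub> (1 - x t)) / (1 - w t)\<close>, with \<open>w\<close> outside \<open>A\<close> and \<open>x\<close> outside \<open>Y\<close>.  Each
  factor is a polynomial of degree at most \<open>n-s\<close> plus a tail divisible by \<open>w \<Prod>\<^bsub>x\<^esub> (w - x)\<close>, and the
  tails vanish after multiplication by \<open>\<Delta>(Y)\<close>.
\<close>

subsection \<open>Vandermonde determinants in Newton bases\<close>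

definition vdm :: "nat \<Rightarrow> (nat \<Rightarrow> 'a::comm_ring_1) \<Rightarrow> 'a" where
  "vdm s a = (\<Prod>w<s. \<Prod>v<w. a w - a v)"

definition newton :: "(nat \<Rightarrow> 'a::comm_ring_1) \<Rightarrow> nat \<Rightarrow> 'a \<Rightarrow> 'a" where
  "newton c i x = (\<Prod>m<i. x - c m)"

lemma newton_basis_change:
  fixes c c' :: "nat \<Rightarrow> 'a::comm_ring_1"
  shows "\<exists>g. g i = 1 \<and> (\<forall>j>i. g j = 0) \<and> (\<forall>x. newton c i x = (\<Sum>j\<le>i. g j * newton c' j x))"
proof (induction i)
  case 0
  show ?case by (rule exI[of _ "\<lambda>j. if j = 0 then 1 else 0"]) (auto simp: newton_def)
next
  case (Suc i)
  then obtain g where g: "g i = 1" "\<forall>j>i. g j = 0"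
    "\<And>x. newton c i x = (\<Sum>j\<le>i. g j * newton c' j x)" by blast
  \<comment> \<open>Splitting \<open>x - c i\<close> as \<open>(x - c' j) + (c' j - c i)\<close>
    sends basis element \<open>j\<close> to basis element \<open>j + 1\<close> plus a multiple of
    itself.\<close>
  define h where "h j = (if j = 0 then 0 else g (j - 1)) + (c' j - c i) * g j" for j
  have "newton c (Suc i) x = (\<Sum>j\<le>Suc i. h j * newton c' j x)" for x
  proof -
    have "newton c (Suc i) x = (\<Sum>j\<le>i. g j * newton c' j x) * (x - c i)"
      unfolding g(3)[symmetric] by (simp add: newton_def)
    also have "\<dots> = (\<Sum>j\<le>i. g j * newton c' (Suc j) x + (c' j - c i) * g j * newton c' j x)"
      unfolding sum_distrib_right
      by (rule sum.cong) (auto simp: newton_def algebra_simps)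
    also have "\<dots> = (\<Sum>j\<le>i. g j * newton c' (Suc j) x) + (\<Sum>j\<le>Suc i. (c' j - c i) * g j * newton c' j x)"
      using g(2) by (simp add: sum.distrib)
    also have "(\<Sum>j\<le>i. g j * newton c' (Suc j) x)
        = (\<Sum>j\<le>Suc i. (if j = 0 then 0 else g (j - 1)) * newton c' j x)"
      by (subst sum.atMost_Suc_shift) simp
    finally show ?thesis
      by (simp add: h_def sum.distrib[symmetric] distrib_right del: sum.atMost_Suc)
  qed
  moreover have "h (Suc i) = 1" "\<forall>j>Suc i. h j = 0"
    using g(1,2) by (auto simp: h_def)
  ultimately show ?case by blast
qed

text \<open>For the nodes \<open>c = a\<close> the matrix is triangular, and a change of nodes is unitriangular.\<close>
lemma det_newton:
  fixes a c :: "nat \<Rightarrow> 'a::comm_ring_1"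
  shows "det (mat s s (\<lambda>(l, i). newton c i (a l))) = vdm s a"
proof -
  obtain U where U: "\<And>i. U i i = 1" "\<And>i j. j > i \<Longrightarrow> U i j = 0"
    "\<And>i x. newton c i x = (\<Sum>j\<le>i. U i j * newton a j x)"
    using newton_basis_change[of _ c a] by metis
  let ?A = "mat s s (\<lambda>(l, i). newton a i (a l))"
  let ?U = "mat s s (\<lambda>(j, i). U i j)"
  have "mat s s (\<lambda>(l, i). newton c i (a l)) = ?A * ?U"
  proof (rule eq_matI)
    fix l i assume "l < dim_row (?A * ?U)" "i < dim_col (?A * ?U)"
    then have li: "l < s" "i < s" by auto
    have "(\<Sum>j\<le>i. U i j * newton a j (a l)) = (\<Sum>j<s. U i j * newton a j (a l))"
      using li U(2) by (intro sum.mono_neutral_left) auto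
    then show "mat s s (\<lambda>(l, i). newton c i (a l)) $$ (l, i) = (?A * ?U) $$ (l, i)"
      using li by (simp add: U(3) scalar_prod_def mult.commute lessThan_atLeast0)
  qed auto
  moreover have "det ?U = 1"
    by (subst det_upper_triangular[of _ s]) (auto simp: upper_triangular_def U prod_list_diag_prod)
  moreover have "newton a i (a l) = 0" if "l < i" for l i
    using that by (auto simp: newton_def intro!: prod_zero)
  then have "det ?A = vdm s a"
    by (subst det_lower_triangular[of s])
       (auto simp: prod_list_diag_prod vdm_def newton_def lessThan_atLeast0)
  ultimately show ?thesis
    by (simp add: det_mult[of _ s])
qed

text \<open>The nodes stay free because \<open>fcong_tuple_series\<close> needs two choices:
  \<open>-1, -2, ...\<close> for integer arguments and \<open>0\<close> for geometric
  series.\<close>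

lemma vdm_leibniz:
  fixes a c :: "nat \<Rightarrow> 'a::comm_ring_1"
  shows "vdm s a = (\<Sum>p | p permutes {0..<s}. signof p * (\<Prod>l<s. newton c (p l) (a l)))"
proof -
  let ?A = "mat s s (\<lambda>(l, i). newton c i (a l))"
  have "(\<Prod>l = 0..<s. ?A $$ (l, p l)) = (\<Prod>l<s. newton c (p l) (a l))"
    if "p permutes {0..<s}" for p
    unfolding lessThan_atLeast0
  proof (rule prod.cong[OF refl])
    fix l assume "l \<in> {0..<s}"
    moreover from this have "p l \<in> {0..<s}"
      unfolding permutes_in_image[OF that] .
    ultimately show "?A $$ (l, p l) = newton c (p l) (a l)" by simp
  qed
  then have "det ?A = (\<Sum>p | p permutes {0..<s}. signof p * (\<Prod>l<s. newton c (p l) (a l)))"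
    unfolding det_def'[OF mat_carrier] by (intro sum.cong refl) simp
  then show ?thesis unfolding det_newton .
qed

lemma vdm_permute:
  fixes a :: "nat \<Rightarrow> 'a::comm_ring_1"
  assumes p: "p permutes {0..<s}"
  shows "vdm s (\<lambda>l. a (p l)) = signof p * vdm s a"
proof -
  let ?A = "mat s s (\<lambda>(l, i). newton (\<lambda>_. 0) i (a l))"
  have "mat s s (\<lambda>(l, i). newton (\<lambda>_. 0) i (a (p l))) = mat s s (\<lambda>(i, j). ?A $$ (p i, j))"
    by (rule eq_matI) (use p in auto)
  then show ?thesis
    using det_permute_rows[of ?A s p] p det_newton[of s "\<lambda>_. 0" "\<lambda>l. a (p l)"]
    by (simp add: det_newton)
qed

lemma vdm_cong: "(\<And>l. l < s \<Longrightarrow> a l = b l) \<Longrightarrow> vdm s a = vdm s b"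
  unfolding vdm_def by (intro prod.cong refl) auto

lemma vdm_eq_0:
  assumes "v < s" "w < s" "v \<noteq> w" "a v = a w"
  shows "vdm s a = 0"
proof -
  have *: "vdm s a = 0" if "v < w" "w < s" "a v = a w" for v w
  proof -
    have "(\<Prod>v<w. a w - a v) = 0"
      using that by (intro prod_zero) (auto intro!: bexI[of _ v])
    then show ?thesis
      using that(2) unfolding vdm_def by (intro prod_zero) (auto intro!: bexI[of _ w])
  qed
  show ?thesis using *[of v w] *[of w v] assms by (cases "v < w") auto
qed

subsection \<open>Polynomial differential operators\<close>

definition mfact :: "(nat \<Rightarrow>\<^sub>0 nat) \<Rightarrow> rat" where
  "mfact m = (\<Prod>i\<in>Poly_Mapping.keys m. fact (Poly_Mapping.lookup m i))"

lemma mfact_nonzero: "mfact m \<noteq> 0"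
  by (simp add: mfact_def)

lemma mfact_superset:
  assumes "finite S" "Poly_Mapping.keys m \<subseteq> S"
  shows "mfact m = (\<Prod>i\<in>S. fact (Poly_Mapping.lookup m i))"
  unfolding mfact_def using assms
  by (intro prod.mono_neutral_left) (auto simp: in_keys_iff)

lemma mfact_add_single:
  "mfact (m + Poly_Mapping.single i 1) = (of_nat (Poly_Mapping.lookup m i) + 1) * mfact m"
proof -
  let ?S = "insert i (Poly_Mapping.keys m)"
  have k: "Poly_Mapping.keys (m + Poly_Mapping.single i 1) \<subseteq> ?S"
    using keys_add[of m "Poly_Mapping.single i 1"] by auto
  have "(\<Prod>j\<in>?S - {i}. fact (Poly_Mapping.lookup (m + Poly_Mapping.single i 1) j) :: rat)
      = (\<Prod>j\<in>?S - {i}. fact (Poly_Mapping.lookup m j))"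
    by (rule prod.cong) (auto simp: lookup_add lookup_single)
  then show ?thesis
    by (subst (1 2) mfact_superset[of ?S]) (use k in \<open>auto simp: prod.remove[of ?S i] lookup_add\<close>)
qed

text \<open>In this normalisation of the coefficients, differentiation is a shift.\<close>
definition ncoeff :: "mpoly \<Rightarrow> (nat \<Rightarrow>\<^sub>0 nat) \<Rightarrow> rat" where
  "ncoeff p m = mfact m * Poly_Mapping.lookup p m"

lemma ncoeff_eqI: "(\<And>b. ncoeff p b = ncoeff q b) \<Longrightarrow> p = q"
  by (rule poly_mapping_eqI) (auto simp: ncoeff_def mfact_nonzero)

lemma ncoeff_zero [simp]: "ncoeff 0 b = 0"
  by (simp add: ncoeff_def)

lemma ncoeff_add: "ncoeff (p + q) b = ncoeff p b + ncoeff q b"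
  by (simp add: ncoeff_def lookup_add distrib_left)

lemma ncoeff_sum: "ncoeff (sum f A) b = (\<Sum>x\<in>A. ncoeff (f x) b)"
  by (simp add: ncoeff_def lookup_sum sum_distrib_left)

lemma lookup_pd:
  "Poly_Mapping.lookup (pd i p) b
   = (of_nat (Poly_Mapping.lookup b i) + 1) * Poly_Mapping.lookup p (b + Poly_Mapping.single i 1)"
proof -
  let ?c = "\<lambda>m. of_nat (Poly_Mapping.lookup m i) * Poly_Mapping.lookup p m"
  let ?b = "b + Poly_Mapping.single i 1"
  \<comment> \<open>Subtraction of exponents is truncated, so a monomial without the variable
    \<open>i\<close> could also hit \<open>b\<close>; its coefficient here is
    \<open>0\<close>.\<close>
  have eq: "(?c m when m - Poly_Mapping.single i 1 = b) = (?c m when m = ?b)" for m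
  proof (cases "Poly_Mapping.lookup m i = 0")
    case True
    then show ?thesis by (auto simp: lookup_add)
  next
    case False
    then have "m - Poly_Mapping.single i 1 + Poly_Mapping.single i 1 = m"
      by (intro poly_mapping_eqI) (auto simp: lookup_add lookup_minus lookup_single when_def)
    then have "m - Poly_Mapping.single i 1 = b \<longleftrightarrow> m = ?b"
      using add_diff_cancel_right'[of b "Poly_Mapping.single i 1"] by (metis (lifting))
    then show ?thesis by (simp only:)
  qed
  have "Poly_Mapping.lookup (pd i p) b
      = (\<Sum>m\<in>Poly_Mapping.keys p. ?c m when m - Poly_Mapping.single i 1 = b)"
    unfolding pd_def lookup_sum lookup_single ..
  also have "\<dots> = (\<Sum>m\<in>Poly_Mapping.keys p. ?c m when m = ?b)"
    unfolding eq ..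
  also have "\<dots> = ?c ?b"
    unfolding when_def by (subst sum.delta) (auto simp: in_keys_iff)
  finally show ?thesis by (simp add: lookup_add)
qed

lemma ncoeff_pd: "ncoeff (pd i p) b = ncoeff p (b + Poly_Mapping.single i 1)"
  by (simp add: ncoeff_def lookup_pd mfact_add_single del: One_nat_def)

lemma ncoeff_pd_power: "ncoeff ((pd i ^^ r) p) b = ncoeff p (b + Poly_Mapping.single i r)"
proof (induction r arbitrary: b)
  case (Suc r)
  have "Poly_Mapping.single i 1 + Poly_Mapping.single i r = Poly_Mapping.single i (Suc r)"
    by (simp add: single_add[symmetric])
  then show ?case by (simp add: ncoeff_pd Suc add.assoc del: One_nat_def)
qed simp

lemma ncoeff_fold_pd:
  "ncoeff (fold (\<lambda>i. pd i ^^ Poly_Mapping.lookup m i) xs p) b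
   = ncoeff p (b + (\<Sum>i\<leftarrow>xs. Poly_Mapping.single i (Poly_Mapping.lookup m i)))"
  by (induction xs arbitrary: p) (simp_all add: ncoeff_pd_power ac_simps)

lemma sum_singles_lookup:
  "(\<Sum>m\<in>Poly_Mapping.keys p. Poly_Mapping.single m (Poly_Mapping.lookup p m)) = p"
  by (rule poly_mapping_eqI) (auto simp: lookup_sum lookup_single when_def sum.delta' in_keys_iff)

text \<open>The linear extension of \<open>\<phi>\<close> from monomials to polynomials;
  \<open>ncoeff_diffop\<close> expresses differential operators through it.\<close>

definition papply :: "mpoly \<Rightarrow> ((nat \<Rightarrow>\<^sub>0 nat) \<Rightarrow> rat) \<Rightarrow> rat" where
  "papply g \<phi> = (\<Sum>m\<in>Poly_Mapping.keys g. Poly_Mapping.lookup g m * \<phi> m)"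

lemma papply_superset:
  assumes "finite S" "Poly_Mapping.keys g \<subseteq> S"
  shows "papply g \<phi> = (\<Sum>m\<in>S. Poly_Mapping.lookup g m * \<phi> m)"
  unfolding papply_def using assms
  by (intro sum.mono_neutral_left) (auto simp: in_keys_iff)

lemma papply_add: "papply (f + g) \<phi> = papply f \<phi> + papply g \<phi>"
  by (subst (1 2 3) papply_superset[of "Poly_Mapping.keys f \<union> Poly_Mapping.keys g"])
     (use keys_add[of f g] in \<open>auto simp: lookup_add distrib_right sum.distrib\<close>)

lemma papply_zero [simp]: "papply 0 \<phi> = 0"
  by (simp add: papply_def)

lemma papply_sum: "papply (sum f A) \<phi> = (\<Sum>x\<in>A. papply (f x) \<phi>)"
  by (induction A rule: infinite_finite_induct) (auto simp: papply_add)

lemma papply_single [simp]: "papply (Poly_Mapping.single m c) \<phi> = c * \<phi> m"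
  by (simp add: papply_def)

text \<open>Exponents add when both factors are expanded into monomials; through
  \<open>ncoeff_diffop\<close> this gives the composition rule \<open>diffop_mult\<close>.\<close>

lemma papply_mult: "papply (f * g) \<phi> = papply f (\<lambda>m. papply g (\<lambda>m'. \<phi> (m + m')))"
proof -
  have "papply (f * g) \<phi> = papply ((\<Sum>m\<in>Poly_Mapping.keys f. Poly_Mapping.single m (Poly_Mapping.lookup f m))
      * (\<Sum>m\<in>Poly_Mapping.keys g. Poly_Mapping.single m (Poly_Mapping.lookup g m))) \<phi>"
    unfolding sum_singles_lookup ..
  also have "\<dots> = papply f (\<lambda>m. papply g (\<lambda>m'. \<phi> (m + m')))"
    unfolding sum_product papply_sum mult_single papply_single
    by (simp add: papply_def sum_distrib_left mult.assoc)
  finally show ?thesis .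
qed

lemma ncoeff_cst_mult: "ncoeff (cst c * q) b = c * ncoeff q b"
proof -
  have "Poly_Mapping.lookup (cst c * q) b = c * Poly_Mapping.lookup q b"
    unfolding cst_def mult_map_scale_conv_mult[symmetric]
    by (simp add: Poly_Mapping.map.rep_eq when_def)
  then show ?thesis by (simp add: ncoeff_def)
qed

text \<open>Each derivative shifts normalised coefficients, so a monomial \<open>m\<close> shifts by
  \<open>m\<close>, whatever the order in which its variables are processed.\<close>

lemma ncoeff_diffop: "ncoeff (diffop g p) b = papply g (\<lambda>m. ncoeff p (b + m))"
proof -
  have "(\<Sum>i\<leftarrow>sorted_list_of_set (Poly_Mapping.keys m). Poly_Mapping.single i (Poly_Mapping.lookup m i)) = m"
    for m :: "nat \<Rightarrow>\<^sub>0 nat"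
  proof -
    have "(\<Sum>i\<in>Poly_Mapping.keys m. Poly_Mapping.single i (Poly_Mapping.lookup m i)) = m"
      by (rule poly_mapping_eqI) (auto simp: lookup_sum lookup_single when_def sum.delta' in_keys_iff)
    then show ?thesis by (simp add: sum_list_distinct_conv_sum_set)
  qed
  then show ?thesis
    by (simp add: diffop_def ncoeff_sum ncoeff_cst_mult ncoeff_fold_pd papply_def)
qed

text \<open>This is what makes \<open>vanop n\<close> an ideal.\<close>

lemma diffop_mult: "diffop (f * g) p = diffop f (diffop g p)"
  by (rule ncoeff_eqI) (simp add: ncoeff_diffop papply_mult add.assoc)

lemma diffop_zero [simp]: "diffop 0 p = 0"
  by (simp add: diffop_def)

lemma diffop_zero_right [simp]: "diffop f 0 = 0"
  by (rule ncoeff_eqI) (simp add: ncoeff_diffop papply_def)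

lemma diffop_add: "diffop (f + g) p = diffop f p + diffop g p"
  by (rule ncoeff_eqI) (simp add: ncoeff_add ncoeff_diffop papply_add)

lemma diffop_sum: "diffop (sum f A) p = (\<Sum>x\<in>A. diffop (f x) p)"
  by (induction A rule: infinite_finite_induct) (auto simp: diffop_add)

lemma diffop_one: "diffop 1 p = p"
  by (rule ncoeff_eqI) (simp add: ncoeff_diffop papply_def)

lemma diffop_cst: "diffop (cst c) p = cst c * p"
  by (rule ncoeff_eqI) (simp add: ncoeff_cst_mult, simp add: cst_def ncoeff_diffop)

lemma Xv_power: "Xv j ^ r = Poly_Mapping.single (Poly_Mapping.single j r) 1"
proof (induction r)
  case (Suc r)
  have "Poly_Mapping.single j (Suc 0) + Poly_Mapping.single j r = Poly_Mapping.single j (Suc r)"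
    by (simp add: single_add[symmetric])
  then show ?case unfolding power_Suc Suc by (simp add: Xv_def mult_single)
qed simp

lemma diffop_Xv_power: "diffop (Xv j ^ r) p = (pd j ^^ r) p"
  by (rule ncoeff_eqI) (simp add: ncoeff_diffop Xv_power ncoeff_pd_power)

text \<open>The ideal \<open>K\<close> of the introduction.\<close>
definition vanop :: "nat \<Rightarrow> mpoly set" where
  "vanop n = {f. diffop f (vdm_poly n) = 0}"

lemma vanop_zero [simp]: "0 \<in> vanop n"
  by (simp add: vanop_def)

lemma vanop_add: "f \<in> vanop n \<Longrightarrow> g \<in> vanop n \<Longrightarrow> f + g \<in> vanop n"
  by (simp add: vanop_def diffop_add)

lemma vanop_mult_left: "g \<in> vanop n \<Longrightarrow> f * g \<in> vanop n"
  by (simp add: vanop_def diffop_mult)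

lemma vanop_mult_right: "g \<in> vanop n \<Longrightarrow> g * f \<in> vanop n"
  by (metis mult.commute vanop_mult_left)

lemma vanop_uminus: "f \<in> vanop n \<Longrightarrow> - f \<in> vanop n"
  using vanop_mult_left[of f n "-1"] by simp

lemma vanop_sum: "(\<And>x. x \<in> A \<Longrightarrow> f x \<in> vanop n) \<Longrightarrow> sum f A \<in> vanop n"
  by (induction A rule: infinite_finite_induct) (auto simp: vanop_add)

subsection \<open>Annihilators of the Vandermonde polynomial\<close>

definition mswap :: "nat \<Rightarrow> nat \<Rightarrow> (nat \<Rightarrow>\<^sub>0 nat) \<Rightarrow> (nat \<Rightarrow>\<^sub>0 nat)" where
  "mswap i j m = Poly_Mapping.map_key (Transposition.transpose i j) m"

lemma lookup_mswap: "Poly_Mapping.lookup (mswap i j m) a = Poly_Mapping.lookup m (Transposition.transpose i j a)"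
  by (simp add: mswap_def map_key.rep_eq inj_transpose)

lemma mswap_mswap [simp]: "mswap i j (mswap i j m) = m"
  by (rule poly_mapping_eqI) (simp add: lookup_mswap)

lemma inj_mswap: "inj (mswap i j)"
  by (rule injI) (metis mswap_mswap)

lemma mswap_add: "mswap i j (m + m') = mswap i j m + mswap i j m'"
  by (rule poly_mapping_eqI) (simp add: lookup_mswap lookup_add)

lemma mfact_mswap: "mfact (mswap i j m) = mfact m"
  unfolding mfact_def
  by (rule prod.reindex_bij_witness[of _ "Transposition.transpose i j" "Transposition.transpose i j"])
     (auto simp: in_keys_iff lookup_mswap)

definition swp :: "nat \<Rightarrow> nat \<Rightarrow> mpoly \<Rightarrow> mpoly" where
  "swp i j p = Poly_Mapping.map_key (mswap i j) p"

lemma lookup_swp: "Poly_Mapping.lookup (swp i j p) m = Poly_Mapping.lookup p (mswap i j m)"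
  by (simp add: swp_def map_key.rep_eq inj_mswap)

lemma keys_swp: "Poly_Mapping.keys (swp i j p) = mswap i j ` Poly_Mapping.keys p"
proof safe
  fix m assume "m \<in> Poly_Mapping.keys (swp i j p)"
  then have "mswap i j m \<in> Poly_Mapping.keys p" by (simp add: in_keys_iff lookup_swp)
  then show "m \<in> mswap i j ` Poly_Mapping.keys p" by (rule rev_image_eqI) simp
qed (simp add: in_keys_iff lookup_swp)

lemma swp_single [simp]: "swp i j (Poly_Mapping.single m c) = Poly_Mapping.single (mswap i j m) c"
  by (rule poly_mapping_eqI) (auto simp: lookup_swp lookup_single when_def)

lemma swp_zero [simp]: "swp i j 0 = 0"
  by (rule poly_mapping_eqI) (simp add: lookup_swp)

lemma swp_add: "swp i j (p + q) = swp i j p + swp i j q"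
  by (rule poly_mapping_eqI) (simp add: lookup_swp lookup_add)

lemma swp_diff: "swp i j (p - q) = swp i j p - swp i j q"
  by (rule poly_mapping_eqI) (simp add: lookup_swp lookup_minus)

lemma swp_sum: "swp i j (sum f A) = (\<Sum>x\<in>A. swp i j (f x))"
  by (induction A rule: infinite_finite_induct) (auto simp: swp_add)

lemma swp_mult: "swp i j (p * q) = swp i j p * swp i j q"
proof -
  have e: "swp i j r = (\<Sum>m\<in>Poly_Mapping.keys r. Poly_Mapping.single (mswap i j m) (Poly_Mapping.lookup r m))" for r
    by (subst sum_singles_lookup[of r, symmetric]) (simp only: swp_sum swp_single)
  have "swp i j (p * q) = swp i j ((\<Sum>m\<in>Poly_Mapping.keys p. Poly_Mapping.single m (Poly_Mapping.lookup p m))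
      * (\<Sum>m\<in>Poly_Mapping.keys q. Poly_Mapping.single m (Poly_Mapping.lookup q m)))"
    unfolding sum_singles_lookup ..
  also have "\<dots> = swp i j p * swp i j q"
    unfolding e[of p] e[of q] sum_product swp_sum mult_single swp_single mswap_add ..
  finally show ?thesis .
qed

lemma swp_one [simp]: "swp i j 1 = 1"
proof -
  have "mswap i j 0 = 0" by (rule poly_mapping_eqI) (simp add: lookup_mswap)
  then show ?thesis using swp_single[of i j 0 1] by simp
qed

lemma swp_prod: "swp i j (prod f A) = (\<Prod>x\<in>A. swp i j (f x))"
  by (induction A rule: infinite_finite_induct) (auto simp: swp_mult)

lemma swp_power: "swp i j (p ^ r) = swp i j p ^ r"
  by (induction r) (auto simp: swp_mult)

lemma swp_Xv: "swp i j (Xv a) = Xv (Transposition.transpose i j a)"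
proof -
  have "mswap i j (Poly_Mapping.single a 1) = Poly_Mapping.single (Transposition.transpose i j a) 1"
    by (rule poly_mapping_eqI) (auto simp: lookup_mswap lookup_single when_def transpose_eq_iff)
  then show ?thesis by (simp add: Xv_def)
qed

text \<open>A transposition moves from the polynomial to the functional, so that symmetry of an
  operator can meet antisymmetry of the Vandermonde polynomial.\<close>

lemma papply_swp: "papply (swp i j f) \<phi> = papply f (\<lambda>m. \<phi> (mswap i j m))"
  unfolding papply_def keys_swp
  by (subst sum.reindex) (auto simp: lookup_swp intro: inj_on_subset[OF inj_mswap])

section \<open>Vandermonde products over sets of variables\<close>

definition vset :: "nat set \<Rightarrow> mpoly" where
  "vset Y = (\<Prod>w\<in>Y. \<Prod>v\<in>{v\<in>Y. v < w}. Xv w - Xv v)"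

text \<open>In an increasing list the entries below \<open>ys ! w\<close> are exactly those at
  earlier positions, so the signs agree too.\<close>

lemma vdm_nth_eq_vset:
  assumes "sorted_wrt (<) ys"
  shows "vdm (length ys) (\<lambda>l. Xv (ys ! l)) = vset (set ys)"
proof -
  have bij: "bij_betw ((!) ys) {..<length ys} (set ys)"
    using assms by (intro bij_betw_nth) (auto simp: strict_sorted_iff)
  have inner: "(\<Prod>v\<in>{v \<in> set ys. v < ys ! w}. Xv (ys ! w) - Xv v) = (\<Prod>v<w. Xv (ys ! w) - Xv (ys ! v))"
    if w: "w < length ys" for w
  proof -
    have "{v \<in> set ys. v < ys ! w} = (!) ys ` {..<w}"
    proof safe
      fix v assume "v \<in> set ys" "v < ys ! w"
      then obtain l where l: "l < length ys" "v = ys ! l" by (auto simp: in_set_conv_nth)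
      moreover have "\<not> w \<le> l"
        using l \<open>v < ys ! w\<close> sorted_wrt_nth_less[OF assms, of w l] by (cases "w = l") auto
      ultimately show "v \<in> (!) ys ` {..<w}" by auto
    qed (use w in \<open>auto intro: sorted_wrt_nth_less[OF assms]\<close>)
    moreover have "inj_on ((!) ys) {..<w}"
      by (rule inj_on_subset[OF bij_betw_imp_inj_on[OF bij]]) (use w in auto)
    ultimately show ?thesis by (simp add: prod.reindex)
  qed
  show ?thesis
    unfolding vdm_def vset_def prod.reindex_bij_betw[OF bij, symmetric]
    by (rule prod.cong) (auto simp: inner)
qed

lemma vdm_poly_eq_vset: "vdm_poly n = vset {1..n}"
proof -
  have "vset {1..n} = (\<Prod>w\<in>{1..n}. \<Prod>v\<in>{1..<w}. Xv w - Xv v)"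
    unfolding vset_def by (intro prod.cong) auto
  also have "\<dots> = (\<Prod>(w, v)\<in>Sigma {1..n} (\<lambda>w. {1..<w}). Xv w - Xv v)"
    by (rule prod.Sigma) auto
  also have "\<dots> = vdm_poly n"
    unfolding vdm_poly_def
    by (rule prod.reindex_bij_witness[of _ prod.swap prod.swap]) auto
  finally show ?thesis ..
qed

lemma vdm_poly_eq_vdm: "vdm_poly n = vdm n (\<lambda>l. Xv (Suc l))"
proof -
  have "vdm (length [1..<Suc n]) (\<lambda>l. Xv ([1..<Suc n] ! l)) = vset (set [1..<Suc n])"
    by (rule vdm_nth_eq_vset) (rule sorted_wrt_upt)
  moreover have "set [1..<Suc n] = {1..n}" by auto
  ultimately show ?thesis
    unfolding vdm_poly_eq_vset by (simp add: vdm_def del: upt_Suc)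
qed

text \<open>\<open>vdm\<close> counts positions from \<open>0\<close>, so the variables
  \<open>i\<close> and \<open>j\<close> sit at positions \<open>i - 1\<close> and
  \<open>j - 1\<close>, and their transposition is odd.\<close>

lemma swp_vdm_poly:
  assumes "i \<in> {1..n}" "j \<in> {1..n}" "i \<noteq> j"
  shows "swp i j (vdm_poly n) = - vdm_poly n"
proof -
  let ?\<tau> = "Transposition.transpose (i - 1) (j - 1)"
  have "swp i j (vdm_poly n) = vdm n (\<lambda>l. Xv (Suc (?\<tau> l)))"
    unfolding vdm_poly_eq_vdm vdm_def swp_prod swp_diff swp_Xv
    using assms by (auto simp: Transposition.transpose_def intro!: prod.cong)
  also have "\<dots> = signof ?\<tau> * vdm n (\<lambda>l. Xv (Suc l))"
    by (rule vdm_permute) (use assms in \<open>auto intro!: permutes_swap_id\<close>)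
  also have "\<dots> = - vdm_poly n"
    using assms by (auto simp: vdm_poly_eq_vdm sign_swap_id)
  finally show ?thesis .
qed

section \<open>Homogeneous polynomials and degree bounds\<close>

definition homog :: "nat \<Rightarrow> nat \<Rightarrow> mpoly \<Rightarrow> bool" where
  "homog n D f \<longleftrightarrow> (\<forall>m\<in>Poly_Mapping.keys f. Poly_Mapping.keys m \<subseteq> {1..n} \<and> (\<Sum>i=1..n. Poly_Mapping.lookup m i) = D)"

lemma homog_mult: "homog n D f \<Longrightarrow> homog n E g \<Longrightarrow> homog n (D + E) (f * g)"
proof -
  assume f: "homog n D f" and g: "homog n E g"
  show ?thesis unfolding homog_def
  proof
    fix m assume "m \<in> Poly_Mapping.keys (f * g)"
    then obtain a b where "a \<in> Poly_Mapping.keys f" "b \<in> Poly_Mapping.keys g" "m = a + b"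
      using keys_mult[of f g] by auto
    moreover from this have "Poly_Mapping.keys a \<union> Poly_Mapping.keys b \<subseteq> {1..n}"
      using f g unfolding homog_def by blast
    ultimately show "Poly_Mapping.keys m \<subseteq> {1..n} \<and> (\<Sum>i=1..n. Poly_Mapping.lookup m i) = D + E"
      using f g keys_add[of a b] unfolding homog_def by (simp add: lookup_add sum.distrib) blast
  qed
qed

lemma homog_diff: "homog n D f \<Longrightarrow> homog n D g \<Longrightarrow> homog n D (f - g)"
  unfolding homog_def using keys_diff[of f g] by blast

lemma homog_sum: "(\<And>x. x \<in> A \<Longrightarrow> homog n D (f x)) \<Longrightarrow> homog n D (sum f A)"
  unfolding homog_def using keys_sum[of f A] by blast

lemma homog_one: "homog n 0 1"
  by (simp add: homog_def)

lemma homog_Xv: "a \<in> {1..n} \<Longrightarrow> homog n 1 (Xv a)"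
  by (auto simp: homog_def Xv_def lookup_single when_def)

lemma homog_prod: "(\<And>x. x \<in> A \<Longrightarrow> homog n (d x) (f x)) \<Longrightarrow> homog n (sum d A) (prod f A)"
  by (induction A rule: infinite_finite_induct) (auto simp: homog_one intro: homog_mult)

text \<open>A new maximum forms a pair with every earlier element. The sum is the number of factors
  of \<open>vset Y\<close>, hence its degree.\<close>

lemma card_less_pairs: "finite Y \<Longrightarrow> (\<Sum>w\<in>Y. card {v\<in>Y. v < w}) = card Y choose 2" for Y :: "nat set"
proof (induction Y rule: finite_linorder_max_induct)
  case (insert b A)
  have "{v \<in> insert b A. v < w} = {v\<in>A. v < w}" if "w \<in> A" for w
    using insert that by auto
  moreover have "{v \<in> insert b A. v < b} = A" using insert by auto
  moreover have "b \<notin> A" using insert by auto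
  ultimately show ?case using insert by (simp add: numeral_2_eq_2)
qed simp

lemma homog_vset:
  assumes "Y \<subseteq> {1..n}"
  shows "homog n (card Y choose 2) (vset Y)"
proof -
  have "homog n (\<Sum>w\<in>Y. \<Sum>v\<in>{v\<in>Y. v < w}. 1) (vset Y)"
    unfolding vset_def using assms by (intro homog_prod homog_diff homog_Xv) auto
  then show ?thesis
    using assms card_less_pairs[of Y] finite_subset[OF assms] by simp
qed

text \<open>A new maximum is at least the number of elements below it. In
  \<open>vanop_symmetric\<close> this bounds the degree of a monomial with distinct
  exponents.\<close>

lemma sum_ge_choose_2: "finite A \<Longrightarrow> card A choose 2 \<le> \<Sum>A" for A :: "nat set"
proof (induction A rule: finite_linorder_max_induct)
  case (insert b A)
  have "A \<subseteq> {..<b}" using insert by auto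
  from card_mono[OF _ this] have "card A \<le> b" by simp
  moreover have "b \<notin> A" using insert by auto
  ultimately show ?case using insert by (simp add: numeral_2_eq_2)
qed simp

text \<open>The pairing of f with the Vandermonde determinant against a monomial b vanishes by
  antisymmetry if b has two equal exponents outside Z, and for degree reasons otherwise.\<close>
lemma vanop_symmetric:
  assumes f: "homog n D f" and Z: "Z \<subseteq> {1..n}"
    and sym: "\<And>i j. i \<in> {1..n} - Z \<Longrightarrow> j \<in> {1..n} - Z \<Longrightarrow> swp i j f = f"
    and D: "n choose 2 < D + (n - card Z choose 2)"
  shows "f \<in> vanop n"
proof -
  let ?V = "vdm_poly n"
  have "papply f (\<lambda>m. ncoeff ?V (b + m)) = 0" for b
  proof (cases "inj_on (Poly_Mapping.lookup b) ({1..n} - Z)")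
    case True
    have "ncoeff ?V (b + m) = 0" if m: "m \<in> Poly_Mapping.keys f" for m
    proof (rule ccontr)
      assume "ncoeff ?V (b + m) \<noteq> 0"
      then have "b + m \<in> Poly_Mapping.keys ?V" by (auto simp: ncoeff_def in_keys_iff)
      then have "(\<Sum>i=1..n. Poly_Mapping.lookup (b + m) i) = n choose 2"
        using homog_vset[of "{1..n}" n] by (simp add: homog_def vdm_poly_eq_vset)
      then have "(\<Sum>i=1..n. Poly_Mapping.lookup b i) + D = n choose 2"
        using f m by (simp add: homog_def lookup_add sum.distrib)
      \<comment> \<open>The \<open>n - card Z\<close> distinct exponents outside \<open>Z\<close>
        sum to at least this much, which leaves too little degree for \<open>f\<close>.\<close>
      moreover have "(n - card Z choose 2) \<le> (\<Sum>i=1..n. Poly_Mapping.lookup b i)"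
      proof -
        have "(n - card Z choose 2) = card (Poly_Mapping.lookup b ` ({1..n} - Z)) choose 2"
          using card_image[OF True] card_Diff_subset[OF finite_subset[OF Z] Z] by simp
        also have "\<dots> \<le> \<Sum>(Poly_Mapping.lookup b ` ({1..n} - Z))"
          by (rule sum_ge_choose_2) simp
        also have "\<dots> = (\<Sum>i\<in>{1..n} - Z. Poly_Mapping.lookup b i)"
          using True by (simp add: sum.reindex)
        also have "\<dots> \<le> (\<Sum>i=1..n. Poly_Mapping.lookup b i)"
          by (rule sum_mono2) auto
        finally show ?thesis .
      qed
      ultimately show False using D by linarith
    qed
    then show ?thesis by (simp add: papply_def)
  next
    case False
    then obtain i j where ij: "i \<in> {1..n} - Z" "j \<in> {1..n} - Z" "i \<noteq> j"
      "Poly_Mapping.lookup b i = Poly_Mapping.lookup b j" by (auto simp: inj_on_def)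
    have b: "mswap i j b = b"
      by (rule poly_mapping_eqI) (use ij in \<open>auto simp: lookup_mswap Transposition.transpose_def\<close>)
    have "Poly_Mapping.lookup ?V (mswap i j m) = - Poly_Mapping.lookup ?V m" for m
      using swp_vdm_poly[of i n j] ij by (simp flip: lookup_swp)
    then have anti: "ncoeff ?V (mswap i j m) = - ncoeff ?V m" for m
      by (simp add: ncoeff_def mfact_mswap)
    have "papply f (\<lambda>m. ncoeff ?V (b + m)) = papply (swp i j f) (\<lambda>m. ncoeff ?V (b + m))"
      using sym[OF ij(1,2)] by simp
    also have "\<dots> = papply f (\<lambda>m. ncoeff ?V (mswap i j (b + m)))"
      by (simp add: papply_swp mswap_add b)
    also have "\<dots> = - papply f (\<lambda>m. ncoeff ?V (b + m))"
      by (simp add: anti papply_def sum_negf)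
    finally show ?thesis by simp
  qed
  then have "diffop f ?V = 0"
    by (intro ncoeff_eqI) (simp add: ncoeff_diffop)
  then show ?thesis by (simp add: vanop_def)
qed

text \<open>\<open>esym\<close> handles only initial segments of the variables; \<open>lins\<close>
  and \<open>choose_esymS\<close> involve arbitrary subsets.\<close>

definition esymS :: "nat set \<Rightarrow> nat \<Rightarrow> mpoly" where
  "esymS A r = (\<Sum>B\<in>{B. B \<subseteq> A \<and> card B = r}. \<Prod>b\<in>B. Xv b)"

text \<open>Full symmetry allows \<open>Z = {}\<close> in \<open>vanop_symmetric\<close>, where any
  positive degree is large enough.\<close>

lemma vanop_esymS:
  assumes "r \<ge> 1"
  shows "esymS {1..n} r \<in> vanop n"
proof (rule vanop_symmetric[where Z = "{}" and D = r])
  show "homog n r (esymS {1..n} r)"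
    unfolding esymS_def
  proof (rule homog_sum)
    fix B assume "B \<in> {B. B \<subseteq> {1..n} \<and> card B = r}"
    then have "B \<subseteq> {1..n}" "r = (\<Sum>b\<in>B. 1)" by auto
    then show "homog n r (\<Prod>b\<in>B. Xv b)"
      by (metis (no_types, lifting) homog_prod homog_Xv subsetD)
  qed
  fix i j assume "i \<in> {1..n} - {}" "j \<in> {1..n} - {}"
  then have t: "Transposition.transpose i j a \<in> {1..n} \<longleftrightarrow> a \<in> {1..n}" for a
    by (auto simp: Transposition.transpose_def)
  let ?t = "Transposition.transpose i j"
  have inj: "inj_on ?t B" for B by (auto simp: inj_on_def transpose_eq_iff)
  have "swp i j (esymS {1..n} r) = (\<Sum>B\<in>{B. B \<subseteq> {1..n} \<and> card B = r}. \<Prod>b\<in>?t ` B. Xv b)"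
    unfolding esymS_def swp_sum swp_prod swp_Xv by (simp add: prod.reindex[OF inj])
  also have "\<dots> = esymS {1..n} r"
    unfolding esymS_def
    by (rule sum.reindex_bij_witness[of _ "\<lambda>B. ?t ` B" "\<lambda>B. ?t ` B"])
       (use t in \<open>auto simp: image_image card_image[OF inj]\<close>)
  finally show "swp i j (esymS {1..n} r) = esymS {1..n} r" .
qed (use assms in auto)

lemma choose_2_Suc: "Suc n choose 2 = (n choose 2) + n"
  by (simp add: numeral_2_eq_2)

lemma choose_2_add: "(a + b) choose 2 = (a choose 2) + a * b + (b choose 2)"
  by (induction a) (simp_all add: choose_2_Suc)

text \<open>With \<open>Z = {y}\<close> the degree has to exceed
  \<open>(n choose 2) - (n - 1 choose 2) = n - 1\<close>.\<close>

lemma vanop_Xv_power: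
  assumes "y \<in> {1..n}"
  shows "Xv y ^ n \<in> vanop n"
proof (rule vanop_symmetric[where Z = "{y}" and D = n])
  show "homog n n (Xv y ^ n)"
    using homog_prod[of "{..<n}" n "\<lambda>_. 1" "\<lambda>_. Xv y"] homog_Xv[OF assms] by simp
  show "n choose 2 < n + (n - card {y} choose 2)"
    using assms choose_2_Suc[of "n - 1"] by (cases n) auto
qed (use assms in \<open>auto simp: swp_power swp_Xv Transposition.transpose_def\<close>)

text \<open>The product after \<open>Xv z\<close> has degree exactly
  \<open>(n choose 2) - (n - card Z choose 2)\<close>; the factor \<open>Xv z\<close> lifts it just
  above the bound of \<open>vanop_symmetric\<close>.\<close>

lemma vanop_top:
  assumes Z: "Z \<subseteq> {1..n}" and z: "z \<in> Z"
  shows "Xv z * (vset Z * (\<Prod>w\<in>Z. \<Prod>x\<in>{1..n} - Z. Xv w - Xv x)) \<in> vanop n"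
proof (rule vanop_symmetric[OF _ Z, where D = "1 + ((card Z choose 2) + (\<Sum>w\<in>Z. \<Sum>x\<in>{1..n} - Z. 1))"])
  show "homog n (1 + ((card Z choose 2) + (\<Sum>w\<in>Z. \<Sum>x\<in>{1..n} - Z. 1)))
    (Xv z * (vset Z * (\<Prod>w\<in>Z. \<Prod>x\<in>{1..n} - Z. Xv w - Xv x)))"
    using Z z by (intro homog_mult homog_prod homog_diff homog_vset homog_Xv) auto
next
  have "card ({1..n} - Z) = n - card Z" "card Z \<le> n"
    using Z card_Diff_subset[OF finite_subset[OF Z] Z] card_mono[OF _ Z] by auto
  then show "n choose 2 < 1 + ((card Z choose 2) + (\<Sum>w\<in>Z. \<Sum>x\<in>{1..n} - Z. 1)) + (n - card Z choose 2)"
    using choose_2_add[of "card Z" "n - card Z"] by simp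
next
  fix i j assume ij: "i \<in> {1..n} - Z" "j \<in> {1..n} - Z"
  let ?t = "Transposition.transpose i j"
  have tZ: "?t w = w" if "w \<in> Z" for w
    using that ij by (auto simp: Transposition.transpose_def)
  have "swp i j (vset Z) = vset Z"
    unfolding vset_def swp_prod swp_diff swp_Xv by (intro prod.cong refl) (auto simp: tZ)
  moreover have "(\<Prod>x\<in>{1..n} - Z. Xv w - Xv (?t x)) = (\<Prod>x\<in>{1..n} - Z. Xv w - Xv x)" for w
    by (rule prod.reindex_bij_witness[of _ ?t ?t]) (use ij in \<open>auto simp: Transposition.transpose_def split: if_splits\<close>)
  ultimately show "swp i j (Xv z * (vset Z * (\<Prod>w\<in>Z. \<Prod>x\<in>{1..n} - Z. Xv w - Xv x)))
      = Xv z * (vset Z * (\<Prod>w\<in>Z. \<Prod>x\<in>{1..n} - Z. Xv w - Xv x))"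
    using z by (simp add: swp_mult swp_prod swp_diff swp_Xv tZ)
qed

section \<open>Divisibility between Vandermonde products\<close>

lemma vset_insert:
  assumes "finite Y" "y \<notin> Y"
  shows "\<exists>e. vset (insert y Y) = e * vset Y * (\<Prod>v\<in>Y. Xv v - Xv y)"
proof
  \<comment> \<open>An element \<open>v\<close> of \<open>Y\<close> below \<open>y\<close> enters
    \<open>vset\<close> as \<open>Xv y - Xv v\<close>, opposite to the orientation in the
    claim.\<close>
  let ?e = "\<Prod>v\<in>Y. if v < y then -1 else 1 :: mpoly"
  have a: "(\<Prod>v\<in>{v \<in> insert y Y. v < y}. Xv y - Xv v) = (\<Prod>v\<in>Y. if v < y then Xv y - Xv v else 1)"
    using assms by (subst prod.inter_filter[symmetric]) (auto intro!: prod.cong)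
  have b: "(\<Prod>v\<in>{v \<in> insert y Y. v < w}. Xv w - Xv v)
      = (if y < w then Xv w - Xv y else 1) * (\<Prod>v\<in>{v \<in> Y. v < w}. Xv w - Xv v)" if "w \<in> Y" for w
  proof (cases "y < w")
    case True
    then have "{v \<in> insert y Y. v < w} = insert y {v \<in> Y. v < w}" by auto
    then show ?thesis using True assms by simp
  next
    case False
    then have "{v \<in> insert y Y. v < w} = {v \<in> Y. v < w}" by auto
    then show ?thesis using False by simp
  qed
  have "vset (insert y Y) = (\<Prod>v\<in>Y. if v < y then Xv y - Xv v else 1)
      * ((\<Prod>w\<in>Y. if y < w then Xv w - Xv y else 1) * vset Y)"
    unfolding vset_def prod.insert[OF assms] a
    unfolding prod.distrib[symmetric] by (intro arg_cong2[of _ _ _ _ "(*)"] prod.cong refl b)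
  also have "\<dots> = (\<Prod>v\<in>Y. (if v < y then Xv y - Xv v else 1) * (if y < v then Xv v - Xv y else 1)) * vset Y"
    by (simp add: prod.distrib mult.assoc)
  also have "(\<Prod>v\<in>Y. (if v < y then Xv y - Xv v else 1) * (if y < v then Xv v - Xv y else 1))
      = (\<Prod>v\<in>Y. (if v < y then -1 else 1) * (Xv v - Xv y))"
    using assms by (intro prod.cong) auto
  finally show "vset (insert y Y) = ?e * vset Y * (\<Prod>v\<in>Y. Xv v - Xv y)"
    by (simp add: prod.distrib mult_ac)
qed

text \<open>Adding the elements \<open>u\<close> one at a time by \<open>vset_insert\<close>
  supplies the cross factors \<open>Xv z - Xv u\<close>; signs and differences within
  \<open>U\<close> go into \<open>q\<close>.\<close>

lemma vset_factor:
  assumes "finite U" "finite Z" "U \<inter> Z = {}"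
  shows "\<exists>q. vset (Z \<union> U) = q * (vset Z * (\<Prod>z\<in>Z. \<Prod>u\<in>U. Xv z - Xv u))"
  using assms
proof (induction U rule: finite_induct)
  case empty
  show ?case by (rule exI[of _ 1]) simp
next
  case (insert u U)
  then obtain q where q: "vset (Z \<union> U) = q * (vset Z * (\<Prod>z\<in>Z. \<Prod>u\<in>U. Xv z - Xv u))" by auto
  obtain e where "vset (insert u (Z \<union> U)) = e * vset (Z \<union> U) * (\<Prod>v\<in>Z \<union> U. Xv v - Xv u)"
    using vset_insert[of "Z \<union> U" u] insert by auto
  moreover have "(\<Prod>v\<in>Z \<union> U. Xv v - Xv u) = (\<Prod>v\<in>Z. Xv v - Xv u) * (\<Prod>v\<in>U. Xv v - Xv u)"
    using insert by (intro prod.union_disjoint) auto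
  ultimately have "vset (Z \<union> insert u U)
      = (e * q * (\<Prod>v\<in>U. Xv v - Xv u)) * (vset Z * (\<Prod>z\<in>Z. \<Prod>u\<in>insert u U. Xv z - Xv u))"
    using insert q by (simp add: prod.distrib mult_ac)
  then show ?case by blast
qed

text \<open>By \<open>vset_factor\<close>, \<open>vset Y\<close> contains the differences between
  \<open>Z\<close> and \<open>Y - Z\<close>; they complete the product over
  \<open>{1..n} - Y\<close> to one over \<open>{1..n} - Z\<close>, the form treated in
  \<open>vanop_top\<close>.\<close>

lemma vanop_vset_top:
  assumes Y: "Y \<subseteq> {1..n}" and Z: "Z \<subseteq> Y" and z: "z \<in> Z"
  shows "vset Y * (Xv z * (\<Prod>w\<in>Z. \<Prod>x\<in>{1..n} - Y. Xv w - Xv x)) \<in> vanop n"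
proof -
  obtain q where "vset (Z \<union> (Y - Z)) = q * (vset Z * (\<Prod>z\<in>Z. \<Prod>u\<in>Y - Z. Xv z - Xv u))"
    using vset_factor[of "Y - Z" Z] finite_subset[OF Y] finite_subset[OF Z] by auto
  moreover have "Z \<union> (Y - Z) = Y" using Z by auto
  moreover have "(\<Prod>x\<in>{1..n} - Z. Xv w - Xv x) = (\<Prod>x\<in>Y - Z. Xv w - Xv x) * (\<Prod>x\<in>{1..n} - Y. Xv w - Xv x)" for w
  proof -
    have "{1..n} - Z = (Y - Z) \<union> ({1..n} - Y)" using Y Z by auto
    then show ?thesis using finite_subset[OF Y] by (simp only:) (rule prod.union_disjoint, auto)
  qed
  ultimately have "vset Y * (Xv z * (\<Prod>w\<in>Z. \<Prod>x\<in>{1..n} - Y. Xv w - Xv x))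
      = q * (Xv z * (vset Z * (\<Prod>w\<in>Z. \<Prod>x\<in>{1..n} - Z. Xv w - Xv x)))"
    by (simp add: prod.distrib mult_ac)
  also have "\<dots> \<in> vanop n"
    by (intro vanop_mult_left vanop_top) (use Y Z z in auto)
  finally show ?thesis .
qed

subsection \<open>Generating series modulo the annihilator\<close>

lemma cst_zero [simp]: "cst 0 = 0"
  by (simp add: cst_def)

lemma cst_one [simp]: "cst 1 = 1"
  by (simp add: cst_def)

lemma cst_add: "cst (a + b) = cst a + cst b"
  by (simp add: cst_def single_add)

lemma cst_mult: "cst (a * b) = cst a * cst b"
  by (simp add: cst_def mult_single)

lemma cst_sum: "cst (sum f A) = (\<Sum>x\<in>A. cst (f x))"
  by (induction A rule: infinite_finite_induct) (auto simp: cst_add)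

lemma cst_prod: "cst (prod f A) = (\<Prod>x\<in>A. cst (f x))"
  by (induction A rule: infinite_finite_induct) (auto simp: cst_mult)

lemma cst_of_nat [simp]: "cst (of_nat k) = of_nat k"
  by (simp add: cst_def)

lemma cst_of_int [simp]: "cst (of_int k) = of_int k"
  by (simp add: cst_def)

definition fcong :: "nat \<Rightarrow> mpoly fps \<Rightarrow> mpoly fps \<Rightarrow> bool" where
  "fcong n F G \<longleftrightarrow> (\<forall>m. fps_nth F m - fps_nth G m \<in> vanop n)"

lemma fcong_refl [simp]: "fcong n F F"
  by (simp add: fcong_def)

lemma fcong_sym: "fcong n F G \<Longrightarrow> fcong n G F"
  unfolding fcong_def
proof
  fix m assume "\<forall>m. fps_nth F m - fps_nth G m \<in> vanop n"
  then have "- (fps_nth F m - fps_nth G m) \<in> vanop n" by (blast intro: vanop_uminus)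
  then show "fps_nth G m - fps_nth F m \<in> vanop n" by simp
qed

lemma fcong_trans [trans]: "fcong n F G \<Longrightarrow> fcong n G H \<Longrightarrow> fcong n F H"
  unfolding fcong_def
proof
  fix m assume "\<forall>m. fps_nth F m - fps_nth G m \<in> vanop n" "\<forall>m. fps_nth G m - fps_nth H m \<in> vanop n"
  then have "(fps_nth F m - fps_nth G m) + (fps_nth G m - fps_nth H m) \<in> vanop n"
    by (blast intro: vanop_add)
  then show "fps_nth F m - fps_nth H m \<in> vanop n" by simp
qed

lemma fcong_mult:
  assumes "fcong n F G" "fcong n F' G'"
  shows "fcong n (F * F') (G * G')"
  unfolding fcong_def
proof
  fix m
  have "F * F' - G * G' = (F - G) * F' + G * (F' - G')" by (simp add: algebra_simps)
  then have "fps_nth (F * F') m - fps_nth (G * G') m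
      = fps_nth ((F - G) * F') m + fps_nth (G * (F' - G')) m"
    by (metis fps_sub_nth fps_add_nth)
  also have "\<dots> \<in> vanop n"
    unfolding fps_mult_nth using assms
    by (intro vanop_add vanop_sum) (auto simp: fcong_def intro: vanop_mult_left vanop_mult_right)
  finally show "fps_nth (F * F') m - fps_nth (G * G') m \<in> vanop n" .
qed

lemma fcong_prod: "(\<And>x. x \<in> A \<Longrightarrow> fcong n (F x) (G x)) \<Longrightarrow> fcong n (prod F A) (prod G A)"
  by (induction A rule: infinite_finite_induct) (auto intro: fcong_mult)

lemma fcong_power: "fcong n F G \<Longrightarrow> fcong n (F ^ r) (G ^ r)"
  by (induction r) (auto intro: fcong_mult)

lemma fcong_sum: "(\<And>x. x \<in> A \<Longrightarrow> fcong n (F x) (G x)) \<Longrightarrow> fcong n (sum F A) (sum G A)"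
  unfolding fcong_def fps_sum_nth sum_subtractf[symmetric] by (auto intro: vanop_sum)

lemma fcong_nth: "fcong n F G \<Longrightarrow> fps_nth G m \<in> vanop n \<Longrightarrow> fps_nth F m \<in> vanop n"
  unfolding fcong_def using vanop_add[of "fps_nth F m - fps_nth G m" n "fps_nth G m"] by simp

section \<open>Linear factors 1 - x t and their inverses as power series\<close>

definition geo :: "nat \<Rightarrow> mpoly fps" where
  "geo y = Abs_fps (\<lambda>j. Xv y ^ j)"

definition lin :: "nat \<Rightarrow> mpoly fps" where
  "lin y = 1 - fps_const (Xv y) * fps_X"

definition lins :: "nat set \<Rightarrow> mpoly fps" where
  "lins A = (\<Prod>x\<in>A. lin x)"

lemma nth_lin_mult: "fps_nth (lin x * F) (Suc m) = fps_nth F (Suc m) - Xv x * fps_nth F m"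
  by (simp add: lin_def left_diff_distrib mult.assoc)

lemma nth_lin_mult_0: "fps_nth (lin x * F) 0 = fps_nth F 0"
  by (simp add: lin_def left_diff_distrib mult.assoc)

lemma lin_geo: "lin y * geo y = 1"
proof (rule fps_ext)
  fix m show "fps_nth (lin y * geo y) m = fps_nth 1 m"
    by (cases m) (simp_all add: nth_lin_mult nth_lin_mult_0 geo_def del: fps_mult_nth_0)
qed

lemma nth_lins:
  assumes "finite A"
  shows "fps_nth (lins A) r = (-1) ^ r * esymS A r"
proof -
  have summand: "(\<Prod>x\<in>B. - (fps_const (Xv x) * fps_X)) = fps_X ^ card B * fps_const ((-1) ^ card B * (\<Prod>x\<in>B. Xv x))"
    if "finite B" for B
    using that by (induction B rule: finite_induct) (simp_all add: mult_ac fps_const_neg[symmetric] del: fps_const_neg)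
  have "lins A = (\<Prod>x\<in>A. - (fps_const (Xv x) * fps_X) + 1)"
    by (simp add: lins_def lin_def)
  also have "\<dots> = (\<Sum>B\<in>Pow A. fps_X ^ card B * fps_const ((-1) ^ card B * (\<Prod>x\<in>B. Xv x)))"
    unfolding prod_add[OF assms] by (intro sum.cong refl) (use assms in \<open>auto simp: summand finite_subset\<close>)
  finally have "fps_nth (lins A) r = (\<Sum>B\<in>Pow A. if card B = r then (-1) ^ r * (\<Prod>x\<in>B. Xv x) else 0)"
    by (auto simp: fps_sum_nth fps_X_power_mult_nth intro!: sum.cong)
  also have "\<dots> = (\<Sum>B\<in>{B. B \<subseteq> A \<and> card B = r}. (-1) ^ r * (\<Prod>x\<in>B. Xv x))"
    unfolding Pow_def using assms by (subst sum.inter_filter[symmetric]) auto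
  finally show ?thesis by (simp add: esymS_def sum_distrib_left)
qed

text \<open>Beyond the constant term \<open>1\<close>, the coefficients are up to sign elementary
  symmetric polynomials of positive degree, covered by \<open>vanop_esymS\<close>.\<close>

lemma fcong_lins_full: "fcong n (lins {1..n}) 1"
  unfolding fcong_def
proof
  fix m
  show "fps_nth (lins {1..n}) m - fps_nth 1 m \<in> vanop n"
  proof (cases m)
    case 0
    have "{B. B \<subseteq> {1..n} \<and> card B = 0} = {{}}"
      using finite_subset[of _ "{1..n}"] by auto
    then show ?thesis by (simp add: 0 nth_lins esymS_def)
  next
    case (Suc r)
    then show ?thesis
      using vanop_mult_left[OF vanop_esymS[of m n], of "(-1) ^ m"] by (simp add: nth_lins)
  qed
qed

text \<open>Multiply \<open>fcong_lins_full\<close> by the inverses of the factors over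
  \<open>Y\<close>. The exchange of linear factors for geometric series on the complement is later
  used in both directions.\<close>

lemma fcong_lins_compl:
  assumes "Y \<subseteq> {1..n}"
  shows "fcong n (lins ({1..n} - Y)) (\<Prod>y\<in>Y. geo y)"
proof -
  have "lins {1..n} = lins Y * lins ({1..n} - Y)"
    unfolding lins_def using assms by (simp add: prod.subset_diff mult.commute)
  moreover have "(\<Prod>y\<in>Y. geo y) * lins Y = 1"
    unfolding lins_def prod.distrib[symmetric] by (simp add: mult.commute[of "geo _"] lin_geo)
  ultimately have "lins ({1..n} - Y) = (\<Prod>y\<in>Y. geo y) * lins {1..n}"
    by (simp flip: mult.assoc)
  then show ?thesis
    using fcong_mult[OF fcong_refl fcong_lins_full, of n "\<Prod>y\<in>Y. geo y"] by simp
qed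

text \<open>From index \<open>card C\<close> on the coefficients form a geometric progression with
  ratio \<open>Xv w\<close>; a further factor \<open>lin x\<close> multiplies them by
  \<open>Xv w - Xv x\<close> and delays the start by one.\<close>

lemma nth_lins_geo:
  assumes "finite C"
  shows "fps_nth (lins C * geo w) (card C + b) = Xv w ^ b * (\<Prod>x\<in>C. Xv w - Xv x)"
  using assms
proof (induction C arbitrary: b rule: finite_induct)
  case empty
  show ?case by (simp add: lins_def geo_def)
next
  case (insert x C)
  have "fps_nth (lins (insert x C) * geo w) (card (insert x C) + b)
      = fps_nth (lin x * (lins C * geo w)) (Suc (card C + b))"
    using insert by (simp add: lins_def mult.assoc)
  also have "\<dots> = fps_nth (lins C * geo w) (card C + Suc b) - Xv x * fps_nth (lins C * geo w) (card C + b)"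
    by (simp add: nth_lin_mult)
  also have "\<dots> = Xv w ^ b * (\<Prod>x\<in>insert x C. Xv w - Xv x)"
    unfolding insert.IH using insert by (simp add: algebra_simps)
  finally show ?case .
qed

definition fdeg :: "nat \<Rightarrow> mpoly fps \<Rightarrow> bool" where
  "fdeg N F \<longleftrightarrow> (\<forall>m>N. fps_nth F m = 0)"

lemma fdeg_mult: "fdeg M F \<Longrightarrow> fdeg N G \<Longrightarrow> fdeg (M + N) (F * G)"
  unfolding fdeg_def fps_mult_nth
proof (intro allI impI sum.neutral ballI)
  fix m i assume "\<forall>m>M. fps_nth F m = 0" "\<forall>m>N. fps_nth G m = 0" "M + N < m" "i \<in> {0..m}"
  then show "fps_nth F i * fps_nth G (m - i) = 0"
    by (cases "i > M") auto
qed

lemma fdeg_prod: "(\<And>x. x \<in> A \<Longrightarrow> fdeg N (F x)) \<Longrightarrow> fdeg (card A * N) (prod F A)"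
proof (induction A rule: infinite_finite_induct)
  case (insert x A)
  then have "fdeg (N + card A * N) (F x * prod F A)" by (intro fdeg_mult) auto
  then show ?case using insert by simp
qed (auto simp: fdeg_def)

text \<open>Multiplied by \<open>vset Y\<close>, every term of the expanded product that contains a tail \<open>R\<close> lies in
  \<open>vanop n\<close>; the remaining one has degree at most \<open>card W * (n - card Y)\<close>.\<close>
lemma vanop_vset_lins_geo:
  assumes Y: "Y \<subseteq> {1..n}" and W: "W \<subseteq> {1..n}"
    and m: "m > card W * (n - card Y)"
  shows "fps_nth (fps_const (vset Y) * (\<Prod>w\<in>W. lins ({1..n} - Y) * geo w)) m \<in> vanop n"
proof -
  define C where "C = {1..n} - Y"
  have C: "finite C" "card C = n - card Y"
    unfolding C_def using Y card_Diff_subset[OF finite_subset[OF Y] Y] by auto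
  define c where "c w = (\<Prod>x\<in>C. Xv w - Xv x)" for w
  \<comment> \<open>The cutoff keeps index \<open>card C\<close>, so the tail \<open>R w\<close>
    starts one later and carries the extra factor \<open>Xv w\<close> that
    \<open>vanop_vset_top\<close> asks for.\<close>
  define Q where "Q w = fps_cutoff (Suc (card C)) (lins C * geo w)" for w
  define R where "R w = fps_const (Xv w * c w) * (fps_X ^ Suc (card C) * geo w)" for w
  have QR: "lins C * geo w = R w + Q w" for w
  proof (rule fps_ext)
    fix m
    show "fps_nth (lins C * geo w) m = fps_nth (R w + Q w) m"
    proof (cases "m < Suc (card C)")
      case True
      then show ?thesis
        by (simp add: Q_def R_def fps_cutoff_def fps_X_power_mult_nth del: power_Suc)
    next
      case False
      then obtain b where b: "m = card C + Suc b"
        by (metis add_Suc_right add_Suc less_iff_Suc_add not_less_eq not_less)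
      show ?thesis
        unfolding b nth_lins_geo[OF C(1)] R_def fps_add_nth fps_mult_left_const_nth fps_X_power_mult_nth
        by (simp add: Q_def c_def geo_def fps_cutoff_def mult_ac)
    qed
  qed
  have fin: "finite W" using W by (rule finite_subset) simp
  have "(\<Prod>w\<in>W. lins C * geo w) = (\<Sum>Z\<in>Pow W. (\<Prod>w\<in>Z. R w) * (\<Prod>w\<in>W - Z. Q w))"
    unfolding QR by (rule prod_add[OF fin])
  then have "fps_nth (fps_const (vset Y) * (\<Prod>w\<in>W. lins C * geo w)) m
      = (\<Sum>Z\<in>Pow W. vset Y * fps_nth ((\<Prod>w\<in>Z. R w) * (\<Prod>w\<in>W - Z. Q w)) m)"
    by (simp add: fps_sum_nth sum_distrib_left)
  also have "\<dots> \<in> vanop n"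
  proof (rule vanop_sum)
    fix Z assume "Z \<in> Pow W"
    then have Z: "Z \<subseteq> W" by simp
    then have finZ: "finite Z" using fin by (rule finite_subset)
    have R: "(\<Prod>w\<in>Z. R w) = fps_const (\<Prod>w\<in>Z. Xv w * c w) * (\<Prod>w\<in>Z. fps_X ^ Suc (card C) * geo w)"
      using finZ by (induction Z rule: finite_induct) (simp_all add: R_def mult_ac fps_const_mult[symmetric] del: fps_const_mult power_Suc)
    \<comment> \<open>Either there is no tail and the degree bound decides, or some tail has a
      vanishing factor \<open>c z\<close>, or \<open>Z\<close> lies in \<open>Y\<close> and
      \<open>vanop_vset_top\<close> applies.\<close>
    consider "Z = {}" | z where "z \<in> Z" "z \<in> C" | z where "z \<in> Z" "Z \<subseteq> Y"
      using Z W C_def by blast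
    then show "vset Y * fps_nth ((\<Prod>w\<in>Z. R w) * (\<Prod>w\<in>W - Z. Q w)) m \<in> vanop n"
    proof cases
      case 1
      have "fdeg (card W * card C) (\<Prod>w\<in>W. Q w)"
        by (rule fdeg_prod) (auto simp: fdeg_def Q_def fps_cutoff_def)
      then show ?thesis using 1 m C by (simp add: fdeg_def)
    next
      case 2
      then have "c z = 0" using C(1) by (auto simp: c_def)
      then have "(\<Prod>w\<in>Z. R w) = 0" using 2 finZ by (auto simp: R_def intro!: prod_zero bexI[of _ z])
      then show ?thesis by simp
    next
      case 3
      have "vset Y * (Xv z * (\<Prod>w\<in>Z. c w)) \<in> vanop n"
        unfolding c_def C_def using Y 3 by (intro vanop_vset_top) auto
      from vanop_mult_left[OF this, of "\<Prod>w\<in>Z - {z}. Xv w"]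
      have "vset Y * (\<Prod>w\<in>Z. Xv w * c w) \<in> vanop n"
        using finZ 3 by (simp add: prod.distrib prod.remove[of Z z] mult_ac)
      then show ?thesis
        unfolding R mult.assoc fps_mult_left_const_nth by (simp add: vanop_mult_right flip: mult.assoc)
    qed
  qed
  finally show ?thesis unfolding C_def .
qed

section \<open>The generating series of tuples weighted by Vandermonde determinants\<close>

lemma nth_geo_power: "fps_nth (geo y ^ Suc i) j = of_nat ((j + i) choose i) * Xv y ^ j"
proof -
  define B where "B i = Abs_fps (\<lambda>j. of_nat ((j + i) choose i) * Xv y ^ j)" for i
  \<comment> \<open>Pascal's rule for \<open>(j + i) choose i\<close>.\<close>
  have step: "lin y * B (Suc i) = B i" for i
  proof (rule fps_ext)
    fix j show "fps_nth (lin y * B (Suc i)) j = fps_nth (B i) j"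
      by (cases j) (simp_all add: nth_lin_mult nth_lin_mult_0 B_def algebra_simps del: fps_mult_nth_0)
  qed
  have "B i = geo y ^ Suc i"
  proof (induction i)
    case 0
    show ?case by (simp add: B_def geo_def)
  next
    case (Suc i)
    have "B (Suc i) = (lin y * geo y) * B (Suc i)" by (simp add: lin_geo)
    also have "\<dots> = geo y * (lin y * B (Suc i))" by (simp only: mult_ac)
    also have "\<dots> = geo y * B i" unfolding step ..
    finally show ?case using Suc by simp
  qed
  then have "fps_nth (geo y ^ Suc i) j = fps_nth (B i) j" by (simp only:)
  then show ?thesis by (simp only: B_def fps_nth_Abs_fps)
qed

text \<open>With the nodes \<open>-1, -2, \<dots>\<close> the Newton basis has the generating series \<open>geo y ^ Suc i\<close>.\<close>
lemma newton_of_nat: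
  "newton (\<lambda>m. - of_nat (Suc m)) i (of_nat j :: rat) = of_nat (fact i * ((j + i) choose i))"
proof -
  have "newton (\<lambda>m. - of_nat (Suc m)) i (of_nat j :: rat) = pochhammer (of_nat (Suc j)) i"
    by (simp add: newton_def pochhammer_prod lessThan_atLeast0 algebra_simps)
  also have "\<dots> = fact i * of_nat ((j + i) choose i)"
    by (simp add: pochhammer_of_nat binomial_gbinomial gbinomial_pochhammer' add_ac)
  finally show ?thesis by simp
qed

text \<open>Every \<open>g w\<close> occurs in \<open>s - 1\<close> pairs and once more in the
  single product.\<close>

lemma prod_pairs_mult:
  fixes g :: "nat \<Rightarrow> 'a::comm_monoid_mult"
  shows "(\<Prod>w<s. g w) * (\<Prod>w<s. \<Prod>v<w. g w * g v) = (\<Prod>w<s. g w) ^ s"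
proof (induction s)
  case (Suc s)
  have "(\<Prod>w<Suc s. g w) * (\<Prod>w<Suc s. \<Prod>v<w. g w * g v)
      = ((\<Prod>w<s. g w) * (\<Prod>w<s. \<Prod>v<w. g w * g v)) * (g s ^ Suc s * (\<Prod>v<s. g v))"
    by (simp add: prod.distrib mult_ac)
  then show ?case unfolding Suc by (simp add: power_mult_distrib mult_ac)
qed simp

lemma geo_diff: "geo a - geo b = fps_X * (fps_const (Xv a - Xv b) * (geo a * geo b))"
proof -
  have "geo a - geo b = (lin b - lin a) * (geo a * geo b)"
  proof -
    have "(lin b - lin a) * (geo a * geo b) = geo a * (lin b * geo b) - geo b * (lin a * geo a)"
      by (simp add: algebra_simps)
    then show ?thesis by (simp add: lin_geo)
  qed
  also have "lin b - lin a = fps_X * fps_const (Xv a - Xv b)"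
    by (simp add: lin_def algebra_simps flip: fps_const_sub)
  finally show ?thesis by (simp add: mult.assoc)
qed

lemma prod_fps_const: "(\<Prod>v<w. fps_const (h v)) = fps_const (\<Prod>v<w. h v)" for h :: "nat \<Rightarrow> mpoly"
  by (induction w) simp_all

text \<open>By \<open>geo_diff\<close> each of the \<open>s choose 2\<close> differences contributes
  one \<open>fps_X\<close>, one difference of variables and two geometric series.\<close>

lemma vdm_geo:
  "vdm s (\<lambda>l. geo (ys ! l))
   = fps_X ^ (s choose 2) * (fps_const (vdm s (\<lambda>l. Xv (ys ! l))) * (\<Prod>w<s. \<Prod>v<w. geo (ys ! w) * geo (ys ! v)))"
proof -
  have X: "(\<Prod>w<s. \<Prod>v<w. fps_X :: mpoly fps) = fps_X ^ (s choose 2)"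
    by (induction s) (simp_all add: choose_2_Suc power_add binomial_eq_0)
  show ?thesis
    unfolding vdm_def geo_diff prod.distrib X prod_fps_const ..
qed

text \<open>The truncation to exponents below \<open>n\<close> is harmless, because \<open>Xv y ^ n\<close> lies in \<open>vanop n\<close>.\<close>
definition tuple_series :: "nat \<Rightarrow> nat list \<Rightarrow> mpoly fps" where
  "tuple_series n ys = (\<Sum>f\<in>PiE {..<length ys} (\<lambda>_. {..<n}).
     fps_const (cst (vdm (length ys) (\<lambda>l. of_nat (f l))) * (\<Prod>l<length ys. Xv (ys ! l) ^ f l)) * fps_X ^ (\<Sum>l<length ys. f l))"

text \<open>Expanding the weight by \<open>vdm_leibniz\<close> in the Newton basis of
  \<open>newton_of_nat\<close> factors the sum over tuples into one-variable series. These are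
  multiples of powers of \<open>geo\<close>, and \<open>vdm_leibniz\<close> read backwards
  reassembles a Vandermonde determinant of geometric series.\<close>

lemma fcong_tuple_series:
  assumes ys: "sorted_wrt (<) ys" "set ys \<subseteq> {1..n}"
  defines "s \<equiv> length ys"
  shows "fcong n (tuple_series n ys)
    (fps_const (of_nat (\<Prod>i<s. fact i)) * (fps_X ^ (s choose 2) * (fps_const (vset (set ys)) * (\<Prod>y\<in>set ys. geo y) ^ s)))"
proof -
  define c :: "nat \<Rightarrow> rat" where "c = (\<lambda>m. - of_nat (Suc m))"
  define t where "t i l j = fps_const (cst (newton c i (of_nat j)) * Xv (ys ! l) ^ j) * fps_X ^ j" for i l j
  have summand: "fps_const (cst (vdm s (\<lambda>l. of_nat (f l))) * (\<Prod>l<s. Xv (ys ! l) ^ f l)) * fps_X ^ (\<Sum>l<s. f l)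
      = (\<Sum>p | p permutes {0..<s}. of_int (sign p) * (\<Prod>l<s. t (p l) l (f l)))" for f
  proof -
    have "(\<Prod>l<s. t (p l) l (f l))
        = fps_const (cst (\<Prod>l<s. newton c (p l) (of_nat (f l))) * (\<Prod>l<s. Xv (ys ! l) ^ f l)) * fps_X ^ (\<Sum>l<s. f l)" for p
      unfolding t_def prod.distrib prod_fps_const cst_prod power_sum ..
    moreover have "fps_const (cst (vdm s (\<lambda>l. of_nat (f l))) * (\<Prod>l<s. Xv (ys ! l) ^ f l))
        = (\<Sum>p | p permutes {0..<s}. of_int (sign p) * fps_const (cst (\<Prod>l<s. newton c (p l) (of_nat (f l))) * (\<Prod>l<s. Xv (ys ! l) ^ f l)))"
      unfolding vdm_leibniz[of s _ c] cst_sum sum_distrib_right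
      by (simp add: cst_mult fps_of_int[symmetric] mult.assoc fps_ext fps_sum_nth if_distrib cong: if_cong)
    ultimately show ?thesis
      by (simp add: sum_distrib_right mult.assoc)
  qed
  have "tuple_series n ys = (\<Sum>p | p permutes {0..<s}. of_int (sign p) * (\<Prod>l<s. \<Sum>j<n. t (p l) l j))"
    unfolding tuple_series_def s_def[symmetric] summand
    by (subst sum.swap) (simp add: sum_distrib_left[symmetric] prod_sum_PiE)
  also have "fcong n \<dots> (\<Sum>p | p permutes {0..<s}. of_int (sign p) * (\<Prod>l<s. of_nat (fact (p l)) * geo (ys ! l) ^ Suc (p l)))"
  proof (intro fcong_sum fcong_mult[OF fcong_refl] fcong_prod)
    fix p l assume "l \<in> {..<s}"
    then have "ys ! l \<in> set ys" by (auto simp: s_def)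
    then have "ys ! l \<in> {1..n}" using ys(2) by blast
    note van = vanop_Xv_power[OF this]
    show "fcong n (\<Sum>j<n. t (p l) l j) (of_nat (fact (p l)) * geo (ys ! l) ^ Suc (p l))"
      unfolding fcong_def
    proof
      fix m
      have eq: "fps_nth (of_nat (fact (p l)) * geo (ys ! l) ^ Suc (p l)) m
          = of_nat (fact (p l) * ((m + p l) choose (p l))) * Xv (ys ! l) ^ m"
        by (simp only: fps_of_nat[symmetric] fps_mult_left_const_nth nth_geo_power of_nat_mult mult.assoc)
      have "fps_nth (\<Sum>j<n. t (p l) l j) m
          = (\<Sum>j<n. if m = j then of_nat (fact (p l) * ((m + p l) choose (p l))) * Xv (ys ! l) ^ m else 0)"
        unfolding fps_sum_nth t_def newton_of_nat c_def cst_of_nat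
        by (intro sum.cong refl) (auto simp: fps_X_power_nth)
      then have lhs: "fps_nth (\<Sum>j<n. t (p l) l j) m
          = (if m < n then of_nat (fact (p l) * ((m + p l) choose (p l))) * Xv (ys ! l) ^ m else 0)"
        by simp
      show "fps_nth (\<Sum>j<n. t (p l) l j) m - fps_nth (of_nat (fact (p l)) * geo (ys ! l) ^ Suc (p l)) m \<in> vanop n"
      proof (cases "m < n")
        case False
        then have "Xv (ys ! l) ^ m = Xv (ys ! l) ^ (m - n) * Xv (ys ! l) ^ n"
          by (simp add: power_add[symmetric])
        then have "Xv (ys ! l) ^ m \<in> vanop n" by (simp add: van vanop_mult_left)
        then show ?thesis unfolding lhs eq using False by (simp add: vanop_mult_left vanop_uminus)
      next
        case True
        then show ?thesis unfolding lhs eq by simp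
      qed
    qed
  qed
  \<comment> \<open>The factorials \<open>fact (p l)\<close> run through the same values for every
    \<open>p\<close>, and one \<open>geo\<close> taken from each power \<open>Suc (p l)\<close>
    leaves Newton polynomials with nodes \<open>0\<close>.\<close>
  also have "(\<Sum>p | p permutes {0..<s}. of_int (sign p) * (\<Prod>l<s. of_nat (fact (p l)) * geo (ys ! l) ^ Suc (p l)))
      = (\<Sum>p | p permutes {0..<s}. of_nat (\<Prod>i<s. fact i) * ((\<Prod>l<s. geo (ys ! l)) * (of_int (sign p) * (\<Prod>l<s. newton (\<lambda>_. 0) (p l) (geo (ys ! l))))))"
  proof (rule sum.cong[OF refl])
    fix p assume "p \<in> {p. p permutes {0..<s}}"
    then have "(\<Prod>l<s. of_nat (fact (p l)) :: mpoly fps) = (\<Prod>i<s. of_nat (fact i))"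
      using prod.permute[of p "{..<s}" "\<lambda>i. of_nat (fact i) :: mpoly fps"] by (simp add: lessThan_atLeast0 o_def)
    then show "of_int (sign p) * (\<Prod>l<s. of_nat (fact (p l)) * geo (ys ! l) ^ Suc (p l))
      = of_nat (\<Prod>i<s. fact i) * ((\<Prod>l<s. geo (ys ! l)) * (of_int (sign p) * (\<Prod>l<s. newton (\<lambda>_. 0) (p l) (geo (ys ! l)))))"
      by (simp add: prod.distrib newton_def mult_ac)
  qed
  also have "\<dots> = of_nat (\<Prod>i<s. fact i) * ((\<Prod>l<s. geo (ys ! l)) * vdm s (\<lambda>l. geo (ys ! l)))"
    unfolding vdm_leibniz[of s _ "\<lambda>_. 0"] sum_distrib_left ..
  also have "\<dots> = of_nat (\<Prod>i<s. fact i) * (fps_X ^ (s choose 2) * (fps_const (vdm s (\<lambda>l. Xv (ys ! l)))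
      * ((\<Prod>l<s. geo (ys ! l)) * (\<Prod>w<s. \<Prod>v<w. geo (ys ! w) * geo (ys ! v)))))"
    unfolding vdm_geo by (simp add: mult_ac)
  also have "\<dots> = of_nat (\<Prod>i<s. fact i) * (fps_X ^ (s choose 2) * (fps_const (vset (set ys)) * (\<Prod>y\<in>set ys. geo y) ^ s))"
  proof -
    have "(\<Prod>l<s. geo (ys ! l)) = (\<Prod>y\<in>set ys. geo y)"
      unfolding s_def by (rule prod.reindex_bij_betw[OF bij_betw_nth]) (use ys in \<open>auto simp: strict_sorted_iff\<close>)
    then show ?thesis
      unfolding prod_pairs_mult vdm_nth_eq_vset[OF ys(1), folded s_def] by simp
  qed
  finally show ?thesis unfolding fps_of_nat .
qed

text \<open>With \<open>W\<close> the complement of \<open>A\<close>, \<open>lins A\<close> becomes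
  the product of \<open>geo w\<close> over \<open>W\<close>, while the \<open>s\<close>-th power
  over \<open>Y\<close> turns back into linear factors. As \<open>card W = s\<close>, one copy of
  \<open>lins ({1..n} - Y)\<close> is paired with each \<open>w\<close>, and
  \<open>vanop_vset_lins_geo\<close> applies at index \<open>N - (s choose 2)\<close>.\<close>

lemma vanop_tuple_series:
  assumes ys: "sorted_wrt (<) ys" "set ys \<subseteq> {1..n}" "length ys = s"
    and A: "A \<subseteq> {1..n}" "card A = n - s"
    and N: "N > (s choose 2) + s * (n - s)"
  shows "fps_nth (tuple_series n ys * lins A) N \<in> vanop n"
proof -
  define W where "W = {1..n} - A"
  define Y where "Y = set ys"
  define \<kappa> :: mpoly where "\<kappa> = of_nat (\<Prod>i<s. fact i)"
  have cY: "card Y = s" using ys by (auto simp: Y_def strict_sorted_iff distinct_card)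
  have "s \<le> n" using card_mono[of "{1..n}" Y] ys cY by (simp add: Y_def)
  then have W: "W \<subseteq> {1..n}" "card W = s" "A = {1..n} - W"
    using A card_Diff_subset[OF finite_subset[OF A(1)] A(1)] by (auto simp: W_def)
  have "fcong n (tuple_series n ys * lins A)
     ((fps_const \<kappa> * (fps_X ^ (s choose 2) * (fps_const (vset Y) * (\<Prod>y\<in>Y. geo y) ^ s))) * (\<Prod>w\<in>W. geo w))"
    unfolding W(3) Y_def using fcong_tuple_series[OF ys(1,2)] fcong_lins_compl[OF W(1)]
    unfolding ys(3) \<kappa>_def[symmetric] by (rule fcong_mult)
  also have "fcong n \<dots> ((fps_const \<kappa> * (fps_X ^ (s choose 2) * (fps_const (vset Y) * lins ({1..n} - Y) ^ s))) * (\<Prod>w\<in>W. geo w))"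
    by (intro fcong_mult fcong_refl fcong_power fcong_sym[OF fcong_lins_compl]) (use ys in \<open>simp add: Y_def\<close>)
  also have "\<dots> = fps_X ^ (s choose 2) * (fps_const \<kappa> * (fps_const (vset Y) * (\<Prod>w\<in>W. lins ({1..n} - Y) * geo w)))"
    by (simp add: prod.distrib W(2) mult_ac)
  finally show ?thesis
  proof (rule fcong_nth)
    have "fps_nth (fps_const (vset Y) * (\<Prod>w\<in>W. lins ({1..n} - Y) * geo w)) (N - (s choose 2)) \<in> vanop n"
      by (rule vanop_vset_lins_geo) (use ys W N cY in \<open>auto simp: Y_def\<close>)
    then show "fps_nth (fps_X ^ (s choose 2) * (fps_const \<kappa> * (fps_const (vset Y) * (\<Prod>w\<in>W. lins ({1..n} - Y) * geo w)))) N \<in> vanop n"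
      unfolding fps_X_power_mult_nth using N
      by (subst fps_mult_left_const_nth) (simp add: vanop_mult_left del: fps_mult_left_const_nth)
  qed
qed

lemma nth_tuple_series_mult:
  "fps_nth (tuple_series n ys * G) N = (\<Sum>f\<in>PiE {..<length ys} (\<lambda>_. {..<n}).
     cst (vdm (length ys) (\<lambda>l. of_nat (f l))) * (\<Prod>l<length ys. Xv (ys ! l) ^ f l)
     * (if N < (\<Sum>l<length ys. f l) then 0 else fps_nth G (N - (\<Sum>l<length ys. f l))))"
  unfolding tuple_series_def sum_distrib_right fps_sum_nth mult.assoc
    fps_mult_left_const_nth fps_X_power_mult_nth ..

subsection \<open>Laplace expansion of the differential forms\<close>

lemma diffop_uminus: "diffop (- f) p = - diffop f p"
  using diffop_add[of f "- f" p] by (simp add: eq_neg_iff_add_eq_0 add.commute)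

lemma diffop_sign_mult: "diffop ((-1) ^ c * f) p = (-1) ^ c * diffop f p"
  by (induction c) (simp_all add: diffop_uminus)

text \<open>The symbol of the operator acting in the coefficient of theta_T, peeling off the
  leftmost \<open>dop\<close>; by \<open>lap_eq_det\<close> it is a determinant of powers of
  variables.\<close>

fun lap :: "nat \<Rightarrow> nat list \<Rightarrow> nat set \<Rightarrow> mpoly" where
  "lap n [] T = (if T = {} then 1 else 0)"
| "lap n (i # js) T = (\<Sum>j\<in>{1..n} \<inter> T. (-1) ^ card {t\<in>T. t < j} * (Xv j ^ i * lap n js (T - {j})))"

lemma dprod_eq_diffop_lap: "dprod n js (sconst p) T = diffop (lap n js T) p"
proof (induction js arbitrary: T)
  case Nil
  show ?case by (simp add: dprod_def sconst_def diffop_one)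
next
  case (Cons i js)
  have "dprod n (i # js) (sconst p) T
      = (\<Sum>j=1..n. if j \<in> T then (-1) ^ card {t\<in>T. t < j} * (pd j ^^ i) (dprod n js (sconst p) (T - {j})) else 0)"
    unfolding dprod_def by (simp add: dop_def theta_mul_def)
  also have "\<dots> = (\<Sum>j\<in>{1..n} \<inter> T. (-1) ^ card {t\<in>T. t < j} * (pd j ^^ i) (dprod n js (sconst p) (T - {j})))"
    by (rule sum.inter_restrict[symmetric]) simp
  also have "\<dots> = diffop (lap n (i # js) T) p"
    unfolding lap.simps diffop_sum diffop_sign_mult diffop_mult[of "Xv _ ^ _"] diffop_Xv_power Cons ..
  finally show ?case .
qed

lemma lap_eq_0: "\<not> (T \<subseteq> {1..n} \<and> card T = length js) \<Longrightarrow> lap n js T = 0"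
proof (induction js arbitrary: T)
  case Nil
  then show ?case by (auto simp: subset_eq)
next
  case (Cons i js)
  have "lap n js (T - {j}) = 0" if j: "j \<in> {1..n} \<inter> T" for j
  proof (rule Cons.IH, rule notI)
    assume a: "T - {j} \<subseteq> {1..n} \<and> card (T - {j}) = length js"
    then have "T \<subseteq> {1..n}" using j by blast
    moreover from this have "card T = Suc (length js)"
      using a j card_Suc_Diff1[of T j] finite_subset[of T "{1..n}"] by auto
    ultimately show False using Cons.prems by simp
  qed
  then show ?case by (simp add: sum.neutral)
qed

text \<open>Expansion along the common prefix has coefficients independent of \<open>x\<close>, so a
  relation valid for all \<open>T\<close> survives in the ideal. This disposes of the fixed
  indices.\<close>

lemma vanop_lap_append:
  assumes "\<And>T. (\<Sum>x\<in>S. g x * lap n (h x) T) \<in> vanop n"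
  shows "(\<Sum>x\<in>S. g x * lap n (pre @ h x) T) \<in> vanop n"
proof (induction pre arbitrary: T)
  case Nil
  show ?case using assms by simp
next
  case (Cons i pre)
  have "(\<Sum>x\<in>S. g x * lap n ((i # pre) @ h x) T)
      = (\<Sum>j\<in>{1..n} \<inter> T. \<Sum>x\<in>S. g x * ((-1) ^ card {t\<in>T. t < j} * (Xv j ^ i * lap n (pre @ h x) (T - {j}))))"
    by (simp add: sum_distrib_left) (rule sum.swap)
  also have "\<dots> = (\<Sum>j\<in>{1..n} \<inter> T. ((-1) ^ card {t\<in>T. t < j} * Xv j ^ i) * (\<Sum>x\<in>S. g x * lap n (pre @ h x) (T - {j})))"
    unfolding sum_distrib_left by (intro sum.cong refl) (simp only: mult_ac)
  also have "\<dots> \<in> vanop n"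
    by (intro vanop_sum vanop_mult_left Cons.IH)
  finally show ?case .
qed

lemma sorted_wrt_take_drop:
  assumes "sorted_wrt (<) (ys :: nat list)" "a < length ys"
  shows "sorted_wrt (<) (take a ys @ drop (Suc a) ys)"
    and "set (take a ys @ drop (Suc a) ys) = set ys - {ys ! a}"
    and "card {t \<in> set ys. t < ys ! a} = a"
proof -
  have ys: "ys = take a ys @ ys ! a # drop (Suc a) ys"
    using assms(2) by (rule id_take_nth_drop)
  from assms(1) have s: "sorted_wrt (<) (take a ys @ ys ! a # drop (Suc a) ys)"
    using ys by simp
  then show "sorted_wrt (<) (take a ys @ drop (Suc a) ys)"
    by (simp add: sorted_wrt_append)
  have lt: "\<forall>x\<in>set (take a ys). x < ys ! a" and gt: "\<forall>x\<in>set (drop (Suc a) ys). ys ! a < x"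
    using s by (auto simp: sorted_wrt_append)
  have st: "set ys = insert (ys ! a) (set (take a ys) \<union> set (drop (Suc a) ys))"
    by (subst ys) simp
  show "set (take a ys @ drop (Suc a) ys) = set ys - {ys ! a}"
    unfolding st using lt gt by auto
  have "{t \<in> set ys. t < ys ! a} = set (take a ys)"
    unfolding st using lt gt by fastforce
  moreover have "distinct (take a ys)"
    using assms(1) by (simp add: strict_sorted_iff)
  ultimately show "card {t \<in> set ys. t < ys ! a} = a"
    using assms(2) by (simp add: distinct_card)
qed

text \<open>Laplace expansion along the first column; the sign from moving theta_j into place is the
  cofactor sign, because the row of \<open>j\<close> is the number of smaller elements.\<close>

lemma lap_eq_det:
  assumes "sorted_wrt (<) ys" "set ys \<subseteq> {1..n}" "length ys = length js"
  shows "lap n js (set ys) = det (mat (length js) (length js) (\<lambda>(a, b). Xv (ys ! a) ^ (js ! b)))"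
  using assms
proof (induction js arbitrary: ys)
  case Nil
  then show ?case by simp
next
  case (Cons i js)
  define s where "s = length js"
  let ?A = "mat (Suc s) (Suc s) (\<lambda>(a, b). Xv (ys ! a) ^ ((i # js) ! b))"
  have len: "length ys = Suc s" using Cons.prems by (simp add: s_def)
  have bij: "bij_betw ((!) ys) {..<Suc s} (set ys)"
    using Cons.prems(1) len by (intro bij_betw_nth) (auto simp: strict_sorted_iff)
  have "det ?A = (\<Sum>a<Suc s. ?A $$ (a, 0) * cofactor ?A a 0)"
    by (rule laplace_expansion_column[of _ "Suc s"]) auto
  also have "\<dots> = (\<Sum>a<Suc s. (-1) ^ card {t \<in> set ys. t < ys ! a} * (Xv (ys ! a) ^ i * lap n js (set ys - {ys ! a})))"
  proof (rule sum.cong[OF refl])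
    fix a assume "a \<in> {..<Suc s}"
    then have a: "a < length ys" by (simp add: len)
    let ?ys = "take a ys @ drop (Suc a) ys"
    note td = sorted_wrt_take_drop[OF Cons.prems(1) a]
    have "lap n js (set ?ys) = det (mat s s (\<lambda>(a, b). Xv (?ys ! a) ^ (js ! b)))"
      unfolding s_def using td Cons.prems a by (intro Cons.IH) auto
    moreover have "mat_delete ?A a 0 = mat s s (\<lambda>(a, b). Xv (?ys ! a) ^ (js ! b))"
      unfolding mat_delete_def using a len
      by (intro eq_matI) (auto simp: nth_append min_def)
    ultimately show "?A $$ (a, 0) * cofactor ?A a 0
        = (-1) ^ card {t \<in> set ys. t < ys ! a} * (Xv (ys ! a) ^ i * lap n js (set ys - {ys ! a}))"
      using a len td by (simp add: cofactor_def mult_ac)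
  qed
  also have "\<dots> = (\<Sum>j\<in>set ys. (-1) ^ card {t \<in> set ys. t < j} * (Xv j ^ i * lap n js (set ys - {j})))"
    by (rule sum.reindex_bij_betw[OF bij])
  also have "\<dots> = lap n (i # js) (set ys)"
    using Cons.prems(2) by (simp add: Int_absorb1)
  finally show ?case by (simp add: s_def)
qed

lemma lap_leibniz:
  assumes "sorted_wrt (<) ys" "set ys \<subseteq> {1..n}" "length ys = s" "length js = s"
  shows "lap n js (set ys) = (\<Sum>p | p permutes {0..<s}. signof p * (\<Prod>l<s. Xv (ys ! l) ^ (js ! p l)))"
proof -
  let ?A = "mat s s (\<lambda>(a, b). Xv (ys ! a) ^ (js ! b))"
  have "(\<Prod>l = 0..<s. ?A $$ (l, p l)) = (\<Prod>l<s. Xv (ys ! l) ^ (js ! p l))"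
    if "p permutes {0..<s}" for p
    unfolding lessThan_atLeast0
  proof (rule prod.cong[OF refl])
    fix l assume "l \<in> {0..<s}"
    moreover from this have "p l \<in> {0..<s}"
      unfolding permutes_in_image[OF that] .
    ultimately show "?A $$ (l, p l) = Xv (ys ! l) ^ (js ! p l)" by simp
  qed
  then have "det ?A = (\<Sum>p | p permutes {0..<s}. signof p * (\<Prod>l<s. Xv (ys ! l) ^ (js ! p l)))"
    unfolding det_def'[OF mat_carrier] by (intro sum.cong refl) simp
  then show ?thesis using lap_eq_det[of ys n js] assms by simp
qed

section \<open>Sorting tuples into increasing lists\<close>

definition incs :: "nat \<Rightarrow> nat set \<Rightarrow> nat list set" where
  "incs s B = {js. length js = s \<and> sorted_wrt (<) js \<and> set js \<subseteq> B}"

lemma finite_incs: "finite B \<Longrightarrow> finite (incs s B)"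
  unfolding incs_def
  by (rule finite_subset[OF _ finite_lists_length_eq[of B s]]) auto

text \<open>An injective tuple is uniquely an increasing list read through a permutation.\<close>

lemma sum_inj_tuples:
  fixes G :: "(nat \<Rightarrow> nat) \<Rightarrow> 'a::comm_monoid_add"
  shows "(\<Sum>f | f \<in> PiE {..<s} (\<lambda>_. {..<n}) \<and> inj_on f {..<s}. G f)
    = (\<Sum>js\<in>incs s {..<n}. \<Sum>p | p permutes {0..<s}. G (restrict (\<lambda>l. js ! p l) {..<s}))"
proof -
  define h where "h = (\<lambda>(js :: nat list, p). restrict (\<lambda>l. js ! p l) {..<s})"
  let ?P = "incs s {..<n} \<times> {p. p permutes {0..<s}}"
  let ?F = "{f. f \<in> PiE {..<s} (\<lambda>_. {..<n}) \<and> inj_on f {..<s}}"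
  have pim: "p ` {..<s} = {..<s}" if "p permutes {0..<s}" for p
    using permutes_image[OF that] by (simp add: lessThan_atLeast0)
  have him: "h (js, p) ` {..<s} = set js" if "js \<in> incs s {..<n}" "p permutes {0..<s}" for js p
  proof -
    have "h (js, p) ` {..<s} = (!) js ` p ` {..<s}" by (auto simp: h_def image_image)
    also have "\<dots> = set js" unfolding pim[OF that(2)] using that(1)
      by (auto simp: incs_def set_conv_nth)
    finally show ?thesis .
  qed
  have inj_nth: "inj_on ((!) js) {..<s}" if "js \<in> incs s {..<n}" for js
    using that by (auto simp: incs_def strict_sorted_iff inj_on_def nth_eq_iff_index_eq)
  have "inj_on h ?P"
  proof (rule inj_onI)
    fix x y assume x: "x \<in> ?P" and y: "y \<in> ?P" and eq: "h x = h y"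
    obtain js p where xd: "x = (js, p)" by (cases x)
    obtain js' p' where yd: "y = (js', p')" by (cases y)
    have jp: "js \<in> incs s {..<n}" "p permutes {0..<s}" and jp': "js' \<in> incs s {..<n}" "p' permutes {0..<s}"
      using x y xd yd by auto
    have "set js = set js'" using him[OF jp] him[OF jp'] eq xd yd by simp
    then have js: "js = js'"
      using jp jp' by (intro sorted_distinct_set_unique) (auto simp: incs_def strict_sorted_iff)
    have "p l = p' l" for l
    proof (cases "l < s")
      case True
      have "js ! p l = js ! p' l"
        using fun_cong[OF eq, of l] True xd yd js by (simp add: h_def)
      moreover have "p l \<in> {..<s}" "p' l \<in> {..<s}"
        using pim[OF jp(2)] pim[OF jp'(2)] True by auto
      ultimately show ?thesis using inj_nth[OF jp(1)] by (auto dest: inj_onD)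
    next
      case False
      then show ?thesis using jp(2) jp'(2) by (simp add: permutes_not_in)
    qed
    then show "x = y" using xd yd js by auto
  qed
  moreover have "h ` ?P = ?F"
  proof (rule equalityI; rule subsetI)
    fix f assume "f \<in> h ` ?P"
    then obtain js p where f: "f = h (js, p)" and jp: "js \<in> incs s {..<n}" "p permutes {0..<s}" by auto
    have "f \<in> extensional {..<s}" by (simp add: f h_def)
    moreover have "f ` {..<s} \<subseteq> {..<n}" using him[OF jp] jp(1) by (auto simp: f incs_def)
    moreover have "card (f ` {..<s}) = card {..<s}"
      using him[OF jp] jp(1) by (simp add: f incs_def strict_sorted_iff distinct_card)
    then have "inj_on f {..<s}" by (intro eq_card_imp_inj_on) auto
    ultimately show "f \<in> ?F" by (auto simp: PiE_def)
  next
    fix f assume f: "f \<in> ?F"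
    define js where "js = sorted_list_of_set (f ` {..<s})"
    have cs: "card (f ` {..<s}) = s" using f by (simp add: card_image)
    have js: "js \<in> incs s {..<n}" using f by (auto simp: js_def incs_def cs)
    have sj: "set js = f ` {..<s}" by (simp add: js_def)
    \<comment> \<open>\<open>p\<close> sends \<open>l\<close> to the position of \<open>f l\<close>
      in the sorted list; the identity elsewhere is what \<open>permutes\<close> demands.\<close>
    define p where "p l = (if l < s then inv_into {..<s} ((!) js) (f l) else l)" for l
    have im: "(!) js ` {..<s} = f ` {..<s}"
      using js unfolding sj[symmetric] by (auto simp: incs_def set_conv_nth)
    have pl: "p l < s \<and> js ! p l = f l" if "l < s" for l
      using that inv_into_into[of "f l" "(!) js" "{..<s}"] f_inv_into_f[of "f l" "(!) js" "{..<s}"] im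
      by (auto simp: p_def)
    have "inj_on p {0..<s}"
      using f pl by (auto simp: inj_on_def) (metis lessThan_iff)
    moreover have "p ` {0..<s} \<subseteq> {0..<s}" using pl by auto
    ultimately have "p ` {0..<s} = {0..<s}" by (simp add: endo_inj_surj)
    then have "bij_betw p {0..<s} {0..<s}" using \<open>inj_on p {0..<s}\<close> by (simp add: bij_betw_def)
    then have "p permutes {0..<s}"
      by (rule bij_imp_permutes) (simp add: p_def)
    moreover have "f = h (js, p)"
    proof
      fix l show "f l = h (js, p) l"
        using f pl by (cases "l < s") (auto simp: h_def PiE_def extensional_def)
    qed
    ultimately show "f \<in> h ` ?P" using js by auto
  qed
  ultimately have "(\<Sum>f\<in>?F. G f) = (\<Sum>x\<in>?P. G (h x))"
    by (metis (no_types, lifting) sum.reindex_cong)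
  also have "\<dots> = (\<Sum>js\<in>incs s {..<n}. \<Sum>p | p permutes {0..<s}. G (restrict (\<lambda>l. js ! p l) {..<s}))"
    unfolding sum.cartesian_product h_def by (rule sum.cong) auto
  finally show ?thesis .
qed

text \<open>Tuples with a repeated entry have weight \<open>0\<close>. For the others, sorting
  extracts a sign from the weight, and the signed monomials add up to \<open>lap\<close> by
  \<open>lap_leibniz\<close>.\<close>

lemma nth_tuple_series_lap:
  assumes ys: "sorted_wrt (<) ys" "set ys \<subseteq> {1..n}" "length ys = s"
  shows "fps_nth (tuple_series n ys * G) N = (\<Sum>js\<in>incs s {..<n}.
     cst (vdm s (\<lambda>l. of_nat (js ! l))) * (if N < sum_list js then 0 else fps_nth G (N - sum_list js)) * lap n js (set ys))"
proof -
  define w where "w f = cst (vdm s (\<lambda>l. of_nat (f l))) * (\<Prod>l<s. Xv (ys ! l) ^ f l)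
     * (if N < (\<Sum>l<s. f l) then 0 else fps_nth G (N - (\<Sum>l<s. f l)))" for f
  have "fps_nth (tuple_series n ys * G) N = (\<Sum>f\<in>PiE {..<s} (\<lambda>_. {..<n}). w f)"
    unfolding nth_tuple_series_mult ys(3) w_def ..
  also have "\<dots> = (\<Sum>f | f \<in> PiE {..<s} (\<lambda>_. {..<n}) \<and> inj_on f {..<s}. w f)"
  proof (rule sum.mono_neutral_right)
    show "\<forall>f\<in>PiE {..<s} (\<lambda>_. {..<n}) - {f. f \<in> PiE {..<s} (\<lambda>_. {..<n}) \<and> inj_on f {..<s}}. w f = 0"
    proof
      fix f assume "f \<in> PiE {..<s} (\<lambda>_. {..<n}) - {f. f \<in> PiE {..<s} (\<lambda>_. {..<n}) \<and> inj_on f {..<s}}"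
      then obtain x y where "x < s" "y < s" "x \<noteq> y" "f x = f y" by (auto simp: inj_on_def)
      then have "vdm s (\<lambda>l. of_nat (f l) :: rat) = 0" by (intro vdm_eq_0[of x s y]) auto
      then show "w f = 0" by (simp add: w_def)
    qed
  qed (auto intro: finite_PiE)
  also have "\<dots> = (\<Sum>js\<in>incs s {..<n}. \<Sum>p | p permutes {0..<s}. w (restrict (\<lambda>l. js ! p l) {..<s}))"
    by (rule sum_inj_tuples)
  also have "\<dots> = (\<Sum>js\<in>incs s {..<n}.
     cst (vdm s (\<lambda>l. of_nat (js ! l))) * (if N < sum_list js then 0 else fps_nth G (N - sum_list js)) * lap n js (set ys))"
  proof (rule sum.cong[OF refl])
    fix js assume "js \<in> incs s {..<n}"
    then have len: "length js = s" by (simp add: incs_def)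
    have "w (restrict (\<lambda>l. js ! p l) {..<s}) = cst (vdm s (\<lambda>l. of_nat (js ! l)))
       * (if N < sum_list js then 0 else fps_nth G (N - sum_list js)) * (signof p * (\<Prod>l<s. Xv (ys ! l) ^ (js ! p l)))"
      if p: "p permutes {0..<s}" for p
    proof -
      have "vdm s (\<lambda>l. of_nat (restrict (\<lambda>l. js ! p l) {..<s} l) :: rat) = signof p * vdm s (\<lambda>l. of_nat (js ! l))"
        unfolding vdm_permute[OF p, symmetric] by (rule vdm_cong) simp
      moreover have "(\<Sum>l<s. restrict (\<lambda>l. js ! p l) {..<s} l) = sum_list js"
        using sum.permute[OF p, of "(!) js"] by (simp add: sum_list_sum_nth len lessThan_atLeast0 o_def)
      moreover have "(\<Prod>l<s. Xv (ys ! l) ^ restrict (\<lambda>l. js ! p l) {..<s} l) = (\<Prod>l<s. Xv (ys ! l) ^ (js ! p l))"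
        by (rule prod.cong) auto
      ultimately show ?thesis
        unfolding w_def by (simp add: cst_mult mult_ac)
    qed
    then show "(\<Sum>p | p permutes {0..<s}. w (restrict (\<lambda>l. js ! p l) {..<s}))
      = cst (vdm s (\<lambda>l. of_nat (js ! l))) * (if N < sum_list js then 0 else fps_nth G (N - sum_list js)) * lap n js (set ys)"
      unfolding lap_leibniz[OF ys len] sum_distrib_left by (intro sum.cong refl) simp
  qed
  finally show ?thesis .
qed

text \<open>Double counting: an \<open>r\<close>-subset \<open>B\<close> lies in
  \<open>(d + u) choose d\<close> subsets of size \<open>q\<close>, obtained by adding
  \<open>d\<close> of the \<open>d + u\<close> remaining elements. This trades the binomial weight
  for an unweighted sum.\<close>

lemma choose_esymS:
  assumes "r + d = q"
  shows "of_nat ((d + u) choose u) * esymS {1..q + u} r = (\<Sum>A | A \<subseteq> {1..q + u} \<and> card A = q. esymS A r)"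
proof -
  let ?M = "{1..q + u}"
  have "(\<Sum>A | A \<subseteq> ?M \<and> card A = q. esymS A r)
      = (\<Sum>A | A \<subseteq> ?M \<and> card A = q. \<Sum>B\<in>{B. B \<subseteq> ?M \<and> card B = r}. if B \<subseteq> A then \<Prod>b\<in>B. Xv b else 0)"
    unfolding esymS_def
  proof (rule sum.cong[OF refl])
    fix A assume "A \<in> {A. A \<subseteq> ?M \<and> card A = q}"
    then have "{B. B \<subseteq> A \<and> card B = r} = {B \<in> {B. B \<subseteq> ?M \<and> card B = r}. B \<subseteq> A}" by auto
    then show "(\<Sum>B\<in>{B. B \<subseteq> A \<and> card B = r}. \<Prod>b\<in>B. Xv b)
        = (\<Sum>B\<in>{B. B \<subseteq> ?M \<and> card B = r}. if B \<subseteq> A then \<Prod>b\<in>B. Xv b else 0)"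
      by (simp only:) (rule sum.inter_filter, simp)
  qed
  also have "\<dots> = (\<Sum>B\<in>{B. B \<subseteq> ?M \<and> card B = r}. \<Sum>A | A \<subseteq> ?M \<and> card A = q. if B \<subseteq> A then \<Prod>b\<in>B. Xv b else 0)"
    by (rule sum.swap)
  also have "\<dots> = (\<Sum>B\<in>{B. B \<subseteq> ?M \<and> card B = r}. of_nat ((d + u) choose u) * (\<Prod>b\<in>B. Xv b))"
  proof (rule sum.cong[OF refl])
    fix B assume "B \<in> {B. B \<subseteq> ?M \<and> card B = r}"
    then have B: "B \<subseteq> ?M" "card B = r" "finite B" using finite_subset by auto
    have "bij_betw (\<lambda>A. A \<union> B) {A. A \<subseteq> ?M - B \<and> card A = d} {A \<in> {A. A \<subseteq> ?M \<and> card A = q}. B \<subseteq> A}"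
    proof (rule bij_betwI[where g = "\<lambda>A. A - B"])
      show "(\<lambda>A. A \<union> B) \<in> {A. A \<subseteq> ?M - B \<and> card A = d} \<rightarrow> {A \<in> {A. A \<subseteq> ?M \<and> card A = q}. B \<subseteq> A}"
      proof
        fix A assume "A \<in> {A. A \<subseteq> ?M - B \<and> card A = d}"
        then have A: "A \<subseteq> ?M - B" "card A = d" "finite A" using finite_subset by auto
        then have "card (A \<union> B) = card A + card B" using B by (intro card_Un_disjoint) auto
        then show "A \<union> B \<in> {A \<in> {A. A \<subseteq> ?M \<and> card A = q}. B \<subseteq> A}" using A B assms by auto
      qed
      show "(\<lambda>A. A - B) \<in> {A \<in> {A. A \<subseteq> ?M \<and> card A = q}. B \<subseteq> A} \<rightarrow> {A. A \<subseteq> ?M - B \<and> card A = d}"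
        using B assms by (auto simp: card_Diff_subset)
    qed auto
    then have "card {A \<in> {A. A \<subseteq> ?M \<and> card A = q}. B \<subseteq> A} = card {A. A \<subseteq> ?M - B \<and> card A = d}"
      by (simp add: bij_betw_same_card)
    also have "\<dots> = card (?M - B) choose d" by (rule n_subsets) simp
    also have "card (?M - B) = d + u" using B assms by (simp add: card_Diff_subset)
    also have "(d + u) choose d = (d + u) choose u" using binomial_symmetric[of d "d + u"] by simp
    finally have c: "card {A \<in> {A. A \<subseteq> ?M \<and> card A = q}. B \<subseteq> A} = (d + u) choose u" .
    have "(\<Sum>A | A \<subseteq> ?M \<and> card A = q. if B \<subseteq> A then \<Prod>b\<in>B. Xv b else 0)
        = (\<Sum>A\<in>{A \<in> {A. A \<subseteq> ?M \<and> card A = q}. B \<subseteq> A}. \<Prod>b\<in>B. Xv b)"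
      by (rule sum.inter_filter[symmetric]) simp
    then show "(\<Sum>A | A \<subseteq> ?M \<and> card A = q. if B \<subseteq> A then \<Prod>b\<in>B. Xv b else 0)
        = of_nat ((d + u) choose u) * (\<Prod>b\<in>B. Xv b)"
      unfolding sum_constant c .
  qed
  finally show ?thesis by (simp add: esymS_def sum_distrib_left)
qed

lemma vdm_num_eq_vdm: "vdm_num ys = vdm (length ys) (\<lambda>l. of_nat (ys ! l))"
proof -
  have "vdm (length ys) (\<lambda>l. of_nat (ys ! l) :: rat)
      = (\<Prod>(w, v)\<in>Sigma {..<length ys} (\<lambda>w. {..<w}). of_nat (ys ! w) - of_nat (ys ! v))"
    unfolding vdm_def by (rule prod.Sigma) auto
  also have "\<dots> = vdm_num ys"
    unfolding vdm_num_def
    by (rule prod.reindex_bij_witness[of _ prod.swap prod.swap]) auto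
  finally show ?thesis ..
qed

lemma esym_eq_esymS: "esym m (int r) = esymS {1..m} r"
  by (simp add: esym_def esymS_def)

subsection \<open>The relation\<close>

lemma sorted_wrt_less_nth_add_le:
  assumes "sorted_wrt (<) (js :: nat list)" "i \<le> j" "j < length js"
  shows "js ! i + (j - i) \<le> js ! j"
  using assms(2,3)
proof (induction j rule: dec_induct)
  case (step j)
  have "js ! j < js ! Suc j"
    using sorted_wrt_nth_less[OF assms(1), of j "Suc j"] step by simp
  then show ?case using step by simp
qed simp

text \<open>The \<open>s - 1 - l\<close> later entries stay below \<open>n\<close>, so entry
  \<open>l\<close> is at most \<open>n - s + l\<close>. Hence a lower bound on the sum gives one on
  the first entry.\<close>

lemma sum_list_incs_le:
  assumes js: "js \<in> incs s {..<n}" and s: "1 \<le> s"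
  shows "sum_list js \<le> js ! 0 + (\<Sum>l=1..<s. n - s + l)"
proof -
  have len: "length js = s" and sorted: "sorted_wrt (<) js" using js by (auto simp: incs_def)
  have "js ! (s - 1) \<in> set js" using len s by simp
  then have last: "js ! (s - 1) < n" using js by (auto simp: incs_def)
  have "sum_list js = js ! 0 + (\<Sum>l=1..<s. js ! l)"
    using s len by (simp add: sum_list_sum_nth sum.atLeast_Suc_lessThan)
  also have "(\<Sum>l=1..<s. js ! l) \<le> (\<Sum>l=1..<s. n - s + l)"
  proof (rule sum_mono)
    fix l assume "l \<in> {1..<s}"
    then have "js ! l + (s - 1 - l) \<le> js ! (s - 1)"
      using sorted_wrt_less_nth_add_le[OF sorted, of l "s - 1"] len \<open>l \<in> {1..<s}\<close> by auto
    then show "js ! l \<le> n - s + l" using last \<open>l \<in> {1..<s}\<close> by auto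
  qed
  finally show ?thesis by simp
qed

lemma cst_sign: "cst ((-1) ^ d) = (-1) ^ d"
  using cst_of_int[of "(-1) ^ d"] by simp

lemma sum_lessThan_add: "(\<Sum>l<s. c + l) = s * c + (s choose 2)" for c s :: nat
  by (induction s) (simp_all add: choose_2_Suc binomial_eq_0)

text \<open>For each \<open>q\<close>-subset \<open>A\<close> the sum weighted by \<open>H A\<close>
  is a coefficient of \<open>tuple_series n ys * lins A\<close>; summing over \<open>A\<close>
  restores the binomial weights.\<close>

lemma vanop_tail_sum:
  fixes n s u a :: nat
  assumes s: "1 \<le> s" "s \<le> n" and u: "u \<le> s" and a: "1 \<le> a"
  defines "N\<^sub>0 \<equiv> a + (\<Sum>l=1..<s. n - s + l)"
  shows "(\<Sum>js\<in>{js \<in> incs s {1..n - 1}. N\<^sub>0 \<le> sum_list js}.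
      cst ((-1) ^ (sum_list js - N\<^sub>0) * vdm_num js * of_nat (sum_list js - N\<^sub>0 + u choose u))
      * esym (n - s + u) (int (n - s) - (int (sum_list js) - int N\<^sub>0)) * lap n js T) \<in> vanop n"
    (is "(\<Sum>js\<in>?L. ?g js * lap n js T) \<in> _")
proof (cases "T \<subseteq> {1..n} \<and> card T = s")
  case False
  then have "?g js * lap n js T = 0" if "js \<in> ?L" for js
    using lap_eq_0[of T n js] that by (simp add: incs_def)
  then show ?thesis by (simp only: sum.neutral_const vanop_zero cong: sum.cong)
next
  case True
  define ys where "ys = sorted_list_of_set T"
  have T: "finite T" using True finite_subset by auto
  then have ys: "sorted_wrt (<) ys" "set ys \<subseteq> {1..n}" "length ys = s" "set ys = T"
    using True by (auto simp: ys_def)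
  define q where "q = n - s"
  \<comment> \<open>Chosen so that \<open>N - sum_list js\<close> is \<open>q - d\<close>; the
    assumption on \<open>a\<close> puts \<open>N\<close> strictly above the bound in
    \<open>vanop_tuple_series\<close>.\<close>
  define N where "N = N\<^sub>0 + q"
  have "N = a + (\<Sum>l<s. q + l)"
    using s by (simp add: N_def N\<^sub>0_def q_def lessThan_atLeast0 sum.atLeast_Suc_lessThan)
  then have N: "N > (s choose 2) + s * (n - s)"
    using a by (simp add: sum_lessThan_add q_def)
  define H where "H A js = cst (vdm s (\<lambda>l. of_nat (js ! l))) * (if N < sum_list js then 0 else fps_nth (lins A) (N - sum_list js))" for A js
  let ?As = "{A. A \<subseteq> {1..q + u} \<and> card A = q}"
  have HA: "(\<Sum>js\<in>?L. H A js * lap n js T) \<in> vanop n" if A: "A \<in> ?As" for A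
  proof -
    have finA: "finite A" using A finite_subset by auto
    have "{1..q + u} \<subseteq> {1..n}" using u s by (auto simp: q_def)
    then have AU: "A \<subseteq> {1..n}" and cA: "card A = n - s" using A by (auto simp: q_def)
    \<comment> \<open>Lists outside \<open>?L\<close> have sum below \<open>N\<^sub>0\<close>,
      directly or because an entry \<open>0\<close> forces it, so they ask for a coefficient of
      \<open>lins A\<close> beyond its degree.\<close>
    have "H A js = 0" if js: "js \<in> incs s {..<n} - ?L" for js
    proof -
      have "sum_list js < N\<^sub>0"
      proof (cases "0 \<in> set js")
        case True
        then obtain i where i: "i < s" "js ! i = 0" using js by (auto simp: in_set_conv_nth incs_def)
        then have "js ! 0 = 0"
          using sorted_wrt_less_nth_add_le[of js 0 i] js by (auto simp: incs_def)
        then show ?thesis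
          using sum_list_incs_le[of js s n] js s a by (simp add: N\<^sub>0_def)
      next
        case False
        have "set js \<subseteq> {1..n - 1}"
        proof
          fix x assume x: "x \<in> set js"
          have "set js \<subseteq> {..<n}" using js by (simp add: incs_def)
          then have "x < n" "x \<noteq> 0" using x False by (auto intro: gr0I)
          then show "x \<in> {1..n - 1}" by auto
        qed
        then show ?thesis using js by (auto simp: incs_def)
      qed
      then have "N - sum_list js > q" by (simp add: N_def)
      moreover have "esymS A r = 0" if r: "r > q" for r
      proof -
        have "card B < r" if "B \<subseteq> A" for B
          using card_mono[OF finA that] A r by simp
        then have "{B. B \<subseteq> A \<and> card B = r} = {}" by blast
        then show ?thesis by (simp only: esymS_def sum.empty)
      qed
      ultimately show ?thesis by (simp add: H_def nth_lins[OF finA])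
    qed
    then have "(\<Sum>js\<in>?L. H A js * lap n js T) = (\<Sum>js\<in>incs s {..<n}. H A js * lap n js T)"
      by (intro sum.mono_neutral_left finite_incs) (auto simp: incs_def subset_eq Suc_le_eq)
    also have "\<dots> = fps_nth (tuple_series n ys * lins A) N"
      unfolding nth_tuple_series_lap[OF ys(1-3)] H_def ys(4) ..
    also have "\<dots> \<in> vanop n"
      by (rule vanop_tuple_series[OF ys(1-3) AU cA N])
    finally show ?thesis .
  qed
  have "?g js = (\<Sum>A\<in>?As. (-1) ^ q * H A js)" if js: "js \<in> ?L" for js
  proof (cases "sum_list js - N\<^sub>0 \<le> q")
    \<comment> \<open>For \<open>d > q\<close> both sides are \<open>0\<close>: \<open>esym\<close>
      has a negative index and \<open>H\<close> takes its default value.\<close>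
    case False
    then show ?thesis using js by (simp add: esym_def H_def N_def q_def)
  next
    case True
    define d where "d = sum_list js - N\<^sub>0"
    define r where "r = q - d"
    have rd: "r + d = q" and Nr: "N - sum_list js = r" "\<not> N < sum_list js"
      using True js by (auto simp: r_def d_def N_def)
    have "int (n - s) - (int (sum_list js) - int N\<^sub>0) = int r"
      using True js by (auto simp: r_def d_def q_def[symmetric])
    then have "?g js = cst (vdm_num js) * ((-1) ^ d * (of_nat ((d + u) choose u) * esymS {1..q + u} r))"
      by (simp add: esym_eq_esymS cst_mult cst_sign mult_ac flip: d_def q_def)
    also have "\<dots> = (\<Sum>A\<in>?As. cst (vdm_num js) * ((-1) ^ d * esymS A r))"
      unfolding choose_esymS[OF rd] sum_distrib_left ..
    also have "\<dots> = (\<Sum>A\<in>?As. (-1) ^ q * H A js)"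
    proof (rule sum.cong[OF refl])
      fix A assume "A \<in> ?As"
      then have "finite A" using finite_subset by auto
      \<comment> \<open>The constant sign \<open>(-1) ^ q\<close> converts the sign
        \<open>(-1) ^ r\<close> in \<open>nth_lins\<close> into \<open>(-1) ^ d\<close>.\<close>
      moreover have "(-1 :: mpoly) ^ q * (-1) ^ r = (-1) ^ d"
        by (simp add: rd[symmetric] power_add mult_ac flip: power_mult_distrib)
      moreover have "length js = s" using js by (simp add: incs_def)
      ultimately show "cst (vdm_num js) * ((-1) ^ d * esymS A r) = (-1) ^ q * H A js"
        unfolding H_def Nr vdm_num_eq_vdm using Nr(2) by (simp add: nth_lins mult_ac)
    qed
    finally show ?thesis .
  qed
  then have "(\<Sum>js\<in>?L. ?g js * lap n js T) = (\<Sum>js\<in>?L. \<Sum>A\<in>?As. (-1) ^ q * (H A js * lap n js T))"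
    by (intro sum.cong refl) (simp add: sum_distrib_right mult.assoc)
  also have "\<dots> = (\<Sum>A\<in>?As. (-1) ^ q * (\<Sum>js\<in>?L. H A js * lap n js T))"
    unfolding sum_distrib_left by (rule sum.swap)
  also have "\<dots> \<in> vanop n"
    by (intro vanop_sum vanop_mult_left HA)
  finally show ?thesis .
qed

theorem theorem1p13:
  fixes n k s u :: nat and "is" :: "nat list"
  assumes "n \<ge> 2"
    and "length is = k" and "sorted_wrt (<) is" and "set is \<subseteq> {1..n-1}"
    and "1 \<le> s" and "s \<le> k"
    and "\<forall>l < k - s + 1. is ! l \<le> n - k"
    and "\<forall>l\<in>{2..s}. is ! (k - s + l - 1) = n - s + l - 1"
    and "u \<le> s"
  shows "\<forall>T. (\<Sum>js\<in>{js. length js = k \<and> sorted_wrt (<) js \<and> set js \<subseteq> {1..n-1}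
                         \<and> take (k - s) js = take (k - s) is \<and> dsum k s js is \<ge> 0}.
           cst ((-1) ^ nat (dsum k s js is) * vdm_num (drop (k - s) js)
                * of_nat (nat (dsum k s js is) + u choose u))
           * diffop (esym (n - s + u) (int (n - s) - dsum k s js is))
                    (dprod n js (sconst (vdm_poly n)) T)) = 0"
proof
  fix T
  define pre where "pre = take (k - s) is"
  define a where "a = is ! (k - s)"
  \<comment> \<open>The sum of the last \<open>s\<close> entries of \<open>is\<close>:
    \<open>a\<close> followed by the largest admissible values.\<close>
  define N\<^sub>0 where "N\<^sub>0 = a + (\<Sum>l=1..<s. n - s + l)"
  let ?S = "{js. length js = k \<and> sorted_wrt (<) js \<and> set js \<subseteq> {1..n-1}
                         \<and> take (k - s) js = take (k - s) is \<and> dsum k s js is \<ge> 0}"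
  let ?L = "{js \<in> incs s {1..n - 1}. N\<^sub>0 \<le> sum_list js}"
  have len_pre: "length pre = k - s" using assms(2) by (simp add: pre_def)
  have "a \<in> set is" using assms(2,5,6) by (simp add: a_def)
  then have a: "1 \<le> a" using assms(4) by auto
  have "k = card (set is)" using assms(2,3) by (simp add: strict_sorted_iff distinct_card)
  then have "k \<le> n - 1" using card_mono[OF _ assms(4)] by simp
  then have sn: "s \<le> n" using assms(6) by simp
  have sum_tail: "(\<Sum>l\<in>{k - s..<k}. int (f l)) = int (\<Sum>l<s. f (k - s + l))" for f :: "nat \<Rightarrow> nat"
  proof -
    have "(\<Sum>l\<in>{k - s..<k}. int (f l)) = (\<Sum>l\<in>{0 + (k - s)..<s + (k - s)}. int (f l))"
      using assms(6) by simp
    also have "\<dots> = (\<Sum>l = 0..<s. int (f (l + (k - s))))"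
      by (rule sum.shift_bounds_nat_ivl)
    finally show ?thesis by (simp add: lessThan_atLeast0 add.commute)
  qed
  have "(\<Sum>l<s. is ! (k - s + l)) = a + (\<Sum>l=1..<s. is ! (k - s + l))"
    using assms(5) by (simp add: lessThan_atLeast0 sum.atLeast_Suc_lessThan a_def)
  also have "(\<Sum>l=1..<s. is ! (k - s + l)) = (\<Sum>l=1..<s. n - s + l)"
  proof (rule sum.cong[OF refl])
    fix l assume "l \<in> {1..<s}"
    then have "Suc l \<in> {2..s}" by auto
    with assms(8) have "is ! (k - s + Suc l - 1) = n - s + Suc l - 1" by blast
    then show "is ! (k - s + l) = n - s + l" by simp
  qed
  finally have sum_is: "(\<Sum>l<s. is ! (k - s + l)) = N\<^sub>0" unfolding N\<^sub>0_def .
  have dsum_eq: "dsum k s js is = int (sum_list (drop (k - s) js)) - int N\<^sub>0" if "length js = k" for js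
  proof -
    have "(\<Sum>l<s. js ! (k - s + l)) = sum_list (drop (k - s) js)"
      using that assms(6) by (simp add: sum_list_sum_nth lessThan_atLeast0)
    then show ?thesis
      unfolding dsum_def sum_subtractf sum_tail sum_is by simp
  qed
  have S: "?S = (\<lambda>tl. pre @ tl) ` ?L"
  proof (rule equalityI; rule subsetI)
    fix js assume js: "js \<in> ?S"
    then have jd: "js = pre @ drop (k - s) js" unfolding pre_def by (metis (mono_tags, lifting) append_take_drop_id mem_Collect_eq)
    have "sorted_wrt (<) (drop (k - s) js)" "set (drop (k - s) js) \<subseteq> {1..n - 1}"
      using js set_drop_subset[of "k - s" js] by (auto intro: sorted_wrt_drop)
    then have "drop (k - s) js \<in> ?L" using js assms(6) dsum_eq[of js] by (auto simp: incs_def)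
    then show "js \<in> (\<lambda>tl. pre @ tl) ` ?L" using jd by (rule rev_image_eqI)
  next
    fix js assume "js \<in> (\<lambda>tl. pre @ tl) ` ?L"
    then obtain tl where js: "js = pre @ tl" and tl: "tl \<in> incs s {1..n - 1}" "N\<^sub>0 \<le> sum_list tl" by auto
    have len: "length js = k" using js tl len_pre assms(6) by (simp add: incs_def)
    have "{1..n - 1} \<subseteq> {..<n}" using assms(1) by auto
    then have "tl \<in> incs s {..<n}" using tl(1) by (auto simp: incs_def)
    \<comment> \<open>Nonnegative \<open>d\<close> already forces the first tail entry up to
      \<open>a\<close>, and the entries of \<open>pre\<close> lie below \<open>a\<close>, so the
      concatenation is increasing.\<close>
    then have "a \<le> tl ! 0" using sum_list_incs_le[of tl s n] tl(2) assms(5) by (simp add: N\<^sub>0_def)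
    moreover have "tl ! 0 \<le> y" if y: "y \<in> set tl" for y
    proof -
      from y obtain i where "i < length tl" "y = tl ! i" unfolding in_set_conv_nth by blast
      then show ?thesis using sorted_wrt_less_nth_add_le[of tl 0 i] tl(1) by (simp add: incs_def)
    qed
    moreover have "x < a" if x: "x \<in> set pre" for x
    proof -
      from x obtain i where "i < k - s" "x = is ! i" using len_pre unfolding in_set_conv_nth pre_def by auto
      then show ?thesis using sorted_wrt_nth_less[OF assms(3), of i "k - s"] assms(2,5,6) by (simp add: a_def)
    qed
    ultimately have "\<forall>x\<in>set pre. \<forall>y\<in>set tl. x < y" by fastforce
    then have "sorted_wrt (<) js"
      using js tl(1) assms(3) by (simp add: sorted_wrt_append incs_def pre_def sorted_wrt_take)
    moreover have "set js \<subseteq> {1..n - 1}"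
      using js tl(1) assms(4) set_take_subset[of "k - s" "is"] by (auto simp: incs_def pre_def)
    ultimately show "js \<in> ?S"
      using js tl len len_pre dsum_eq[OF len] by (simp add: pre_def)
  qed
  let ?V = "vdm_poly n"
  let ?g = "\<lambda>tl. cst ((-1) ^ (sum_list tl - N\<^sub>0) * vdm_num tl * of_nat (sum_list tl - N\<^sub>0 + u choose u))
      * esym (n - s + u) (int (n - s) - (int (sum_list tl) - int N\<^sub>0))"
  \<comment> \<open>Scalars and elementary symmetric polynomials are absorbed into the symbol, so
    the sum becomes one operator applied to the Vandermonde polynomial.\<close>
  have "(\<Sum>js\<in>?S. cst ((-1) ^ nat (dsum k s js is) * vdm_num (drop (k - s) js)
                * of_nat (nat (dsum k s js is) + u choose u))
           * diffop (esym (n - s + u) (int (n - s) - dsum k s js is)) (dprod n js (sconst ?V) T))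
      = (\<Sum>tl\<in>?L. diffop (?g tl * lap n (pre @ tl) T) ?V)"
    unfolding S
  proof (subst sum.reindex)
    show "inj_on (\<lambda>tl. pre @ tl) ?L" by (simp add: inj_on_def)
    show "sum ((\<lambda>js. cst ((-1) ^ nat (dsum k s js is) * vdm_num (drop (k - s) js)
                * of_nat (nat (dsum k s js is) + u choose u))
           * diffop (esym (n - s + u) (int (n - s) - dsum k s js is)) (dprod n js (sconst ?V) T)) \<circ> (\<lambda>tl. pre @ tl)) ?L
      = (\<Sum>tl\<in>?L. diffop (?g tl * lap n (pre @ tl) T) ?V)"
    proof (rule sum.cong[OF refl])
      fix tl assume tl: "tl \<in> ?L"
      then have "length (pre @ tl) = k" using len_pre assms(6) by (simp add: incs_def)
      from dsum_eq[OF this] have d: "dsum k s (pre @ tl) is = int (sum_list tl) - int N\<^sub>0"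
        by (simp add: len_pre)
      then have nd: "nat (dsum k s (pre @ tl) is) = sum_list tl - N\<^sub>0" by simp
      have dr: "drop (k - s) (pre @ tl) = tl" by (simp add: len_pre)
      show "((\<lambda>js. cst ((-1) ^ nat (dsum k s js is) * vdm_num (drop (k - s) js)
                * of_nat (nat (dsum k s js is) + u choose u))
           * diffop (esym (n - s + u) (int (n - s) - dsum k s js is)) (dprod n js (sconst ?V) T)) \<circ> (\<lambda>tl. pre @ tl)) tl
        = diffop (?g tl * lap n (pre @ tl) T) ?V"
        unfolding o_def nd unfolding d dr dprod_eq_diffop_lap diffop_mult diffop_cst ..
    qed
  qed
  also have "\<dots> = diffop (\<Sum>tl\<in>?L. ?g tl * lap n (pre @ tl) T) ?V"
    by (simp only: diffop_sum)
  also have "\<dots> = 0"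
  proof -
    have "(\<Sum>tl\<in>?L. ?g tl * lap n (pre @ tl) T) \<in> vanop n"
      unfolding N\<^sub>0_def
      by (rule vanop_lap_append) (rule vanop_tail_sum[OF assms(5) sn assms(9) a])
    then show ?thesis by (simp only: vanop_def mem_Collect_eq)
  qed
  finally show "(\<Sum>js\<in>?S. cst ((-1) ^ nat (dsum k s js is) * vdm_num (drop (k - s) js)
                * of_nat (nat (dsum k s js is) + u choose u))
           * diffop (esym (n - s + u) (int (n - s) - dsum k s js is)) (dprod n js (sconst ?V) T)) = 0" .
qed

end
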